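(* Let $q$ be a fixed odd prime power, and let $i_U(n,q)$ denote the number of involutions in the finite unitary group $U(n,q)$. (1) As $n\to\infty$ through even integers, $$\lim_{n \rightarrow \infty} \frac{i_U(n,q)}{q^{n^2/2}} = \prod_{k \geq 1} \frac{(1+q^{2-4k})^2(1-q^{-4k})}{(1-(-1/q)^{k})}.$$ (2) As $n\to\infty$ through odd integers, $$\lim_{n \rightarrow \infty} \frac{i_U(n,q)}{q^{(n^2-1)/2}} = 2 \prod_{k \geq 1} \frac{(1+q^{-4k})^2(1-q^{-4k})}{(1-(-1/q)^{k})}.$$
   Context: $U(n,q)$ is the (general) unitary group: the subgroup of $GL(n,q^2)$ (invertible $n\times n$ matrices over the field with $q^2$ elements) stabilizing a nondegenerate Hermitian form on $\mathbb{F}_{q^2}^n$ (unique up to conjugacy; one may take the standard basis to be orthonormal). "Involution" means an element $g$ with $g^2=1$ (the identity is counted). *)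

theory Defs
  imports
    "HOL-Analysis.Infinite_Products"
    "HOL-Number_Theory.Prime_Powers"
    "Jordan_Normal_Form.Matrix"
begin

text \<open>
  The field with \<open>q\<^sup>2\<close> elements is a type \<open>'a\<close> with \<open>CARD('a) = q\<^sup>2\<close>; on it \<open>x \<mapsto> x ^ q\<close> is the
  involutory automorphism. The form below is the Hermitian form for which the standard basis is
  orthonormal; every nondegenerate Hermitian form is equivalent to it.
\<close>

definition hermitian_form :: "nat \<Rightarrow> 'a :: field vec \<Rightarrow> 'a vec \<Rightarrow> 'a" where
  "hermitian_form q v w = (\<Sum>i<dim_vec v. vec_index v i * vec_index w i ^ q)"

definition general_linear_group :: "nat \<Rightarrow> 'a :: field mat set" where
  "general_linear_group n = {A \<in> carrier_mat n n. invertible_mat A}"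

definition unitary_group :: "nat \<Rightarrow> nat \<Rightarrow> 'a :: field mat set" where
  "unitary_group n q = {A \<in> general_linear_group n. \<forall>v \<in> carrier_vec n. \<forall>w \<in> carrier_vec n.
     hermitian_form q (A *\<^sub>v v) (A *\<^sub>v w) = hermitian_form q v w}"

text \<open>The identity counts as an involution.\<close>

definition num_involutions_U :: "'a :: field itself \<Rightarrow> nat \<Rightarrow> nat \<Rightarrow> nat" where
  "num_involutions_U _ n q = card {A \<in> unitary_group n q :: 'a mat set. A * A = 1\<^sub>m n}"

end

theory Submission
  imports Defs "Jordan_Normal_Form.Determinant" "HOL-Number_Theory.Residues" "HOL-Analysis.Uniform_Limit"
begin

text \<open>
  A unitary involution \<open>A\<close> is the same as a self-adjoint idempotent \<open>P = (1 - A) / 2\<close>, and every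
  such \<open>P\<close> is \<open>B B\<^sup>*\<close> for an \<open>n \<times> k\<close> matrix \<open>B\<close> with orthonormal columns, unique up to right
  multiplication by \<open>U(k, q)\<close>. The orthonormal \<open>k\<close>-tuples are counted by choosing unit vectors one
  after the other, and with \<open>r = -1/q\<close> there are \<open>q\<^bsup>2k(n - k)\<^esup> [n, k]\<^sub>r\<close> projections
  of rank \<open>k\<close>, where \<open>[n, k]\<^sub>r\<close> is the Gaussian binomial coefficient. Centring the sum over \<open>k\<close> at
  \<open>n / 2\<close> turns it into a truncated theta series in \<open>x = q\<^bsup>-2\<^esup>\<close>, and Tannery's theorem gives the
  limit as a theta constant divided by the product of the \<open>1 - r\<^sup>i\<close>. The same passage to
  the limit with base \<open>x\<^sup>2\<close> instead of \<open>r\<close>, where the \<open>q\<close>-binomial theorem evaluates the finite sums in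
  closed form, yields the product formula for the theta constant.
\<close>

subsection \<open>Theta sums and Gaussian binomial coefficients\<close>

text \<open>The q-Pochhammer symbol (t; t)_n.\<close>

definition qpoch :: "real \<Rightarrow> nat \<Rightarrow> real" where
  "qpoch t n = (\<Prod>i<n. 1 - t ^ Suc i)"

text \<open>A quotient suffices, since every base in use satisfies |t| < 1 and then no value of
  \<open>qpoch\<close> vanishes. The value 0 beyond \<open>n\<close> makes Pascal's rule hold at
  \<open>k = n\<close>.\<close>

definition qbinom :: "real \<Rightarrow> nat \<Rightarrow> nat \<Rightarrow> real" where
  "qbinom t n k = (if k \<le> n then qpoch t n / (qpoch t k * qpoch t (n - k)) else 0)"

lemma power_neq_one:
  fixes t :: real
  assumes "\<bar>t\<bar> < 1"
  shows "t ^ Suc i \<noteq> 1"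
proof
  assume "t ^ Suc i = 1"
  then have "\<bar>t\<bar> ^ Suc i = 1" by (metis abs_one power_abs)
  moreover have "\<bar>t\<bar> ^ Suc i < 1" using assms by (subst power_less_one_iff) auto
  ultimately show False by simp
qed

lemma qpoch_Suc: "qpoch t (Suc n) = qpoch t n * (1 - t ^ Suc n)"
  by (simp add: qpoch_def)

lemma qpoch_nonzero: "\<bar>t\<bar> < 1 \<Longrightarrow> qpoch t n \<noteq> 0"
  using power_neq_one[of t] by (auto simp: qpoch_def simp del: power_Suc)

text \<open>Choosing unit vectors one after the other leads to such falling products; they telescope
  to a quotient of two values of \<open>qpoch\<close>.\<close>

lemma prod_qpoch:
  assumes "\<bar>t\<bar> < 1" and "k \<le> n"
  shows "(\<Prod>i<k. 1 - t ^ (n - i)) = qpoch t n / qpoch t (n - k)"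
  using assms(2)
proof (induction k)
  case 0
  then show ?case using qpoch_nonzero[OF assms(1)] by simp
next
  case (Suc k)
  then have "n - k = Suc (n - Suc k)" by simp
  then have "qpoch t (n - k) = qpoch t (n - Suc k) * (1 - t ^ (n - k))"
    by (metis qpoch_Suc)
  with Suc show ?case
    using qpoch_nonzero[OF assms(1), of "n - k"] by simp
qed

lemma qbinom_sym: "k \<le> n \<Longrightarrow> qbinom t n (n - k) = qbinom t n k"
  by (simp add: qbinom_def mult.commute)

text \<open>After clearing common factors this is \<open>1 - t ^ (n + 1) = (1 - t ^ (n - k)) + t ^
  (n - k) * (1 - t ^ (k + 1))\<close>. The case \<open>k = n\<close> is separate because
  \<open>qbinom t n (Suc n)\<close> is 0 by convention.\<close>

lemma qbinom_pascal:
  assumes t: "\<bar>t\<bar> < 1" and k: "k \<le> n"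
  shows "qbinom t (Suc n) (Suc k) = qbinom t n (Suc k) + t ^ (n - k) * qbinom t n k"
proof (cases "k = n")
  case True
  moreover have "qpoch t 0 = 1" by (simp add: qpoch_def)
  ultimately show ?thesis
    using qpoch_nonzero[OF t, of n] qpoch_nonzero[OF t, of "Suc n"] by (simp add: qbinom_def)
next
  case False
  with k obtain l where n: "n = Suc (k + l)"
    using less_imp_Suc_add by (metis le_neq_implies_less)
  have nz: "1 - t ^ Suc i \<noteq> 0" for i using power_neq_one[OF t, of i] by simp
  have nz': "qpoch t i \<noteq> 0" for i by (rule qpoch_nonzero[OF t])
  have diffs: "Suc n - Suc k = Suc l" "n - Suc k = l" "n - k = Suc l" using n by auto
  define a b where "a = 1 - t ^ Suc k" and "b = 1 - t ^ Suc l"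
  have ab: "a \<noteq> 0" "b \<noteq> 0" using nz by (auto simp: a_def b_def)
  define c where "c = t ^ Suc l"
  have "1 - t ^ Suc n = b + c * a"
    by (simp add: n a_def b_def c_def power_add algebra_simps)
  then have eqs: "qpoch t (Suc n) = qpoch t n * (b + c * a)"
    "qpoch t (Suc k) = qpoch t k * a" "qpoch t (Suc l) = qpoch t l * b"
    by (simp_all only: qpoch_Suc a_def b_def)
  have qb: "qbinom t (Suc n) (Suc k) = qpoch t n * (b + c * a) / (qpoch t k * a * (qpoch t l * b))"
    "qbinom t n (Suc k) = qpoch t n / (qpoch t k * a * qpoch t l)"
    "qbinom t n k = qpoch t n / (qpoch t k * (qpoch t l * b))"
    unfolding qbinom_def diffs eqs using n by auto
  show ?thesis
    unfolding qb diffs c_def[symmetric] using ab nz'[of k] nz'[of l] by (simp add: field_simps)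
qed

text \<open>Once the factor \<open>u + t ^ n * y\<close> is split off, the induction step is
  Pascal's rule term by term. The second variable \<open>u\<close> is kept so that it can later be
  set to a power of \<open>x\<close> that centres the product.\<close>

theorem q_binomial_theorem:
  assumes t: "\<bar>t\<bar> < 1"
  shows "(\<Prod>i<n. u + t ^ i * y) = (\<Sum>k\<le>n. t ^ (k choose 2) * qbinom t n k * y ^ k * u ^ (n - k))"
proof (induction n)
  case 0
  then show ?case by (simp add: qbinom_def qpoch_def numeral_2_eq_2)
next
  case (Suc n)
  let ?f = "\<lambda>n k. t ^ (k choose 2) * qbinom t n k * y ^ k"
  have f0: "?f n 0 = 1" for n
    using qpoch_nonzero[OF t, of n] by (simp add: qbinom_def qpoch_def[of _ 0] numeral_2_eq_2)
  have fS: "?f (Suc n) (Suc k) = ?f n (Suc k) + t ^ n * y * ?f n k" if "k \<le> n" for k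
  proof -
    have "Suc k choose 2 = k + (k choose 2)" by (simp add: numeral_2_eq_2)
    then have "t ^ (Suc k choose 2) * t ^ (n - k) = t ^ n * t ^ (k choose 2)"
      using that by (simp add: power_add[symmetric] add.commute)
    then show ?thesis
      unfolding qbinom_pascal[OF t that] by (simp add: algebra_simps)
  qed
  have "(\<Sum>k\<le>Suc n. ?f (Suc n) k * u ^ (Suc n - k))
      = u ^ Suc n + (\<Sum>k\<le>n. (?f n (Suc k) + t ^ n * y * ?f n k) * u ^ (n - k))"
    unfolding sum.atMost_Suc_shift f0
    by (intro arg_cong2[where f = "(+)"] sum.cong refl) (simp_all only: atMost_iff fS diff_Suc_Suc diff_zero mult_1)
  also have "\<dots> = (u ^ Suc n + (\<Sum>k\<le>n. ?f n (Suc k) * u ^ (n - k)))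
      + t ^ n * y * (\<Sum>k\<le>n. ?f n k * u ^ (n - k))"
    by (simp add: distrib_right sum.distrib sum_distrib_left mult.assoc)
  also have "u ^ Suc n + (\<Sum>k\<le>n. ?f n (Suc k) * u ^ (n - k)) = (\<Sum>k\<le>Suc n. ?f n k * u ^ (Suc n - k))"
    unfolding sum.atMost_Suc_shift f0 by simp
  \<comment> \<open>The dropped term has index \<open>Suc n\<close>, where \<open>qbinom t n\<close>
    is 0.\<close>
  also have "\<dots> = (\<Sum>k\<le>n. ?f n k * u ^ (Suc n - k))"
    by (simp add: qbinom_def)
  also have "\<dots> = u * (\<Sum>k\<le>n. ?f n k * u ^ (n - k))"
    by (auto simp: sum_distrib_left Suc_diff_le intro!: sum.cong)
  finally show ?case using Suc by (simp add: algebra_simps)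
qed

section \<open>Centred sums and the finite triple product\<close>

text \<open>The symmetry pairs \<open>k\<close> with \<open>2 * m + e - k\<close>. For
  \<open>e = 1\<close> every index has a distinct partner; for \<open>e = 0\<close> the middle index
  \<open>m\<close> is its own mirror image, whence the weight 1 at \<open>j = 0\<close>.\<close>

lemma sum_fold_symmetric:
  fixes F :: "nat \<Rightarrow> real"
  assumes e: "e \<le> 1" and sym: "\<And>k. k \<le> 2 * m + e \<Longrightarrow> F (2 * m + e - k) = F k"
  shows "(\<Sum>k\<le>2 * m + e. F k) = (\<Sum>j\<le>m. (if e = 0 \<and> j = 0 then 1 else 2) * F (m + e + j))"
proof -
  have lower: "(\<Sum>k<m + e. F k) = (\<Sum>j\<in>{j. j \<le> m \<and> (e = 0 \<longrightarrow> j \<noteq> 0)}. F (m + e + j))"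
  proof (rule sum.reindex_bij_witness[of _ "\<lambda>j. m - j" "\<lambda>k. m - k"])
    fix k assume k: "k \<in> {..<m + e}"
    with e show "m - (m - k) = k" "m - k \<in> {j. j \<le> m \<and> (e = 0 \<longrightarrow> j \<noteq> 0)}"
      by auto
    have "m + e + (m - k) = 2 * m + e - k" using k e by auto
    then show "F (m + e + (m - k)) = F k"
      using sym[of k] k by simp
  qed (use e in auto)
  have "{..2 * m + e} = {..<m + e} \<union> {m + e..2 * m + e}" by auto
  then have "(\<Sum>k\<le>2 * m + e. F k) = (\<Sum>k<m + e. F k) + (\<Sum>k=m + e..2 * m + e. F k)"
    by (simp add: sum.union_disjoint ivl_disj_int)
  also have "(\<Sum>k=m + e..2 * m + e. F k) = (\<Sum>j\<le>m. F (m + e + j))"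
    by (rule sum.reindex_bij_witness[of _ "\<lambda>j. m + e + j" "\<lambda>k. k - (m + e)"]) auto
  also have "(\<Sum>k<m + e. F k) = (\<Sum>j\<le>m. if e = 0 \<longrightarrow> j \<noteq> 0 then F (m + e + j) else 0)"
    unfolding lower by (subst sum.inter_filter[symmetric]) (auto intro!: sum.cong)
  finally show ?thesis
    unfolding sum.distrib[symmetric] by (auto intro!: sum.cong)
qed

text \<open>For \<open>e \<le> 1\<close>, the terms of the theta series with exponents
  \<open>j * (j + e)\<close> over all integers \<open>j\<close>, where \<open>j\<close> and
  \<open>- j - e\<close> have been merged into one term.\<close>

definition theta_weight :: "nat \<Rightarrow> real \<Rightarrow> nat \<Rightarrow> real" where
  "theta_weight e x j = (if e = 0 \<and> j = 0 then 1 else 2) * x ^ (j * (j + e))"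

text \<open>The specializations \<open>y = x\<close> (\<open>e = 0\<close>) and \<open>y = 1\<close> (\<open>e = 1\<close>), with \<open>u = x\<^sup>2\<^sup>m\<close>, of the
  \<open>q\<close>-binomial theorem make the product symmetric about its middle.\<close>
lemma finite_triple_product:
  fixes x :: real
  assumes x: "0 < x" "x < 1" and e: "e \<le> 1"
  shows "(\<Sum>j\<le>m. theta_weight e x j * qbinom (x\<^sup>2) (2 * m + e) (m + e + j))
    = 2 ^ e * (\<Prod>i<m. (1 + x ^ (2 * i + 1 + e))) ^ 2"
proof -
  \<comment> \<open>\<open>x ^ d\<close> is the value given to \<open>y\<close>: it is
    \<open>x\<close> for \<open>e = 0\<close> and 1 for \<open>e = 1\<close>.\<close>
  define d where "d = 1 - e"
  then have de: "d + e = 1" using e by simp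
  \<comment> \<open>Each factor \<open>x ^ (2 * m) + x ^ (2 * i + d)\<close> is divided by the lower
    of its two powers of \<open>x\<close>: \<open>2 * i + d\<close> for \<open>i < m\<close>, and
    \<open>2 * m\<close> for the other \<open>m + e\<close> indices. \<open>K\<close> is the total
    exponent extracted.\<close>
  define K where "K = (\<Sum>i<m. 2 * i + d) + 2 * m * (m + e)"
  have t: "\<bar>x\<^sup>2\<bar> < 1" using x by (simp add: power_less_one_iff)
  have Kval: "K + m * e = 3 * m * m + 2 * m * e"
  proof -
    have "(\<Sum>i<m. 2 * i + d) + m * e = m * m"
    proof (induction m)
      case (Suc m)
      have "(\<Sum>i<Suc m. 2 * i + d) + Suc m * e = ((\<Sum>i<m. 2 * i + d) + m * e) + 2 * m + (d + e)"
        by simp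
      then show ?case unfolding Suc de by simp
    qed simp
    then show ?thesis by (simp add: K_def algebra_simps)
  qed
  have "(\<Prod>i<2 * m + e. x ^ (2 * m) + (x\<^sup>2) ^ i * x ^ d)
      = (\<Prod>i<m. x ^ (2 * m) + x ^ (2 * i + d)) * (\<Prod>i=m..<2 * m + e. x ^ (2 * m) + x ^ (2 * i + d))"
  proof -
    have "{..<2 * m + e} = {..<m} \<union> {m..<2 * m + e}" by auto
    then show ?thesis
      by (simp add: prod.union_disjoint ivl_disj_int power_mult[symmetric] power_add[symmetric])
  qed
  also have "(\<Prod>i<m. x ^ (2 * m) + x ^ (2 * i + d))
      = (\<Prod>i<m. x ^ (2 * i + d) * (1 + x ^ (2 * (m - 1 - i) + 1 + e)))"
  proof (intro prod.cong refl)
    fix i assume "i \<in> {..<m}"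
    then have eq: "2 * m = (2 * i + d) + (2 * (m - 1 - i) + 1 + e)" using de by auto
    have "x ^ (2 * m) = x ^ (2 * i + d) * x ^ (2 * (m - 1 - i) + 1 + e)"
      unfolding power_add[symmetric] using eq by (rule arg_cong)
    then show "x ^ (2 * m) + x ^ (2 * i + d) = x ^ (2 * i + d) * (1 + x ^ (2 * (m - 1 - i) + 1 + e))"
      by (simp add: distrib_left)
  qed
  also have "\<dots> = x ^ (\<Sum>i<m. 2 * i + d) * (\<Prod>i<m. 1 + x ^ (2 * (m - 1 - i) + 1 + e))"
    by (simp only: prod.distrib power_sum)
  also have "(\<Prod>i<m. 1 + x ^ (2 * (m - 1 - i) + 1 + e)) = (\<Prod>i<m. 1 + x ^ (2 * i + 1 + e))"
    by (rule prod.reindex_bij_witness[of _ "\<lambda>i. m - 1 - i" "\<lambda>i. m - 1 - i"]) auto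
  \<comment> \<open>For \<open>e = 1\<close> the middle factor \<open>i = m\<close> has two equal
    summands; this is the origin of the factor 2 in the odd case.\<close>
  also have "(\<Prod>i=m..<2 * m + e. x ^ (2 * m) + x ^ (2 * i + d))
      = (2 * x ^ (2 * m)) ^ e * (\<Prod>i=m + e..<2 * m + e. x ^ (2 * m) + x ^ (2 * i + d))"
  proof (cases "e = 0")
    case False
    with e d_def have "e = 1" "d = 0" by auto
    then show ?thesis by (simp add: prod.atLeast_Suc_lessThan)
  qed simp
  also have "(\<Prod>i=m + e..<2 * m + e. x ^ (2 * m) + x ^ (2 * i + d))
      = (\<Prod>l<m. x ^ (2 * m) * (1 + x ^ (2 * l + 1 + e)))"
  proof (rule prod.reindex_bij_witness[of _ "\<lambda>l. m + e + l" "\<lambda>i. i - (m + e)"])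
    fix i assume i: "i \<in> {m + e..<2 * m + e}"
    then have eq: "2 * i + d = 2 * m + (2 * (i - (m + e)) + 1 + e)" using de by auto
    show "x ^ (2 * m) * (1 + x ^ (2 * (i - (m + e)) + 1 + e)) = x ^ (2 * m) + x ^ (2 * i + d)"
      unfolding eq power_add[of x "2 * m"] by (simp only: distrib_left mult_1_right)
  qed auto
  also have "\<dots> = x ^ (2 * m * m) * (\<Prod>l<m. 1 + x ^ (2 * l + 1 + e))"
    by (simp add: prod.distrib power_mult)
  finally have prod: "(\<Prod>i<2 * m + e. x ^ (2 * m) + (x\<^sup>2) ^ i * x ^ d)
      = x ^ K * (2 ^ e * (\<Prod>l<m. 1 + x ^ (2 * l + 1 + e)) ^ 2)"
    by (simp add: K_def power_add power_mult_distrib power2_eq_square distrib_left power_mult[symmetric] mult_ac)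
  let ?F = "\<lambda>k. (x\<^sup>2) ^ (k choose 2) * qbinom (x\<^sup>2) (2 * m + e) k * (x ^ d) ^ k * (x ^ (2 * m)) ^ (2 * m + e - k)"
  \<comment> \<open>Free of division and subtraction, so that the exponents can be compared within
    the natural numbers.\<close>
  have two: "2 * (k choose 2) + k = k * k" for k :: nat
    by (induction k) (auto simp: numeral_2_eq_2)
  define E where "E k = 2 * (k choose 2) + d * k + 2 * m * (2 * m + e - k)" for k
  have F: "?F k = x ^ E k * qbinom (x\<^sup>2) (2 * m + e) k" for k
    unfolding E_def power_add power_mult by (simp only: mult_ac)
  \<comment> \<open>The exponent is quadratic in the index; expanded about the centre it is the
    constant \<open>K\<close> plus the theta exponent.\<close>
  have E: "E (m + e + j) = K + j * (j + e)" if "j \<le> m" for j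
  proof -
    from le_Suc_ex[OF that] obtain l where l: "m = j + l" by blast
    have *: "E (m + e + j) + (m + e + j) = (m + e + j) * (m + e + j) + d * (m + e + j) + 2 * m * l"
      using two[of "m + e + j"] by (simp add: E_def l)
    show ?thesis
    proof (cases "e = 0")
      case True
      then have "d = 1" using de by simp
      with * Kval True l show ?thesis by (simp add: algebra_simps)
    next
      case False
      then have "e = 1" "d = 0" using de by auto
      with * Kval l show ?thesis by (simp add: algebra_simps)
    qed
  qed
  have Esym: "E (2 * m + e - k) = E k" if "k \<le> 2 * m + e" for k
  proof -
    from le_Suc_ex[OF that] obtain l where l: "2 * m + e = k + l" by blast
    have 1: "E k + k = k * k + d * k + 2 * m * l"
      using two[of k] l by (simp add: E_def)
    have 2: "E l + l = l * l + d * l + 2 * m * k"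
      using two[of l] l by (simp add: E_def)
    have "E l = E k"
    proof (cases "e = 0")
      case True
      then have "d = 1" "2 * m = k + l" using de l by auto
      then show ?thesis using 1 2 by (simp add: algebra_simps)
    next
      case False
      then have e1: "e = 1" "d = 0" using de by auto
      then have "2 * m + 1 = k + l" using l by simp
      then have "2 * m * l + l = (k + l) * l" "2 * m * k + k = (k + l) * k"
        by (metis add_mult_distrib mult_1)+
      then show ?thesis using 1 2 e1 by (simp add: algebra_simps)
    qed
    then show ?thesis using l by simp
  qed
  have "x ^ K * (2 ^ e * (\<Prod>l<m. 1 + x ^ (2 * l + 1 + e)) ^ 2) = (\<Sum>k\<le>2 * m + e. ?F k)"
    unfolding prod[symmetric] by (rule q_binomial_theorem[OF t])
  also have "\<dots> = (\<Sum>k\<le>2 * m + e. x ^ E k * qbinom (x\<^sup>2) (2 * m + e) k)"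
    by (simp only: F)
  also have "\<dots> = (\<Sum>j\<le>m. (if e = 0 \<and> j = 0 then 1 else 2) *
      (x ^ E (m + e + j) * qbinom (x\<^sup>2) (2 * m + e) (m + e + j)))"
    by (rule sum_fold_symmetric[OF e]) (simp add: Esym qbinom_sym)
  also have "\<dots> = x ^ K * (\<Sum>j\<le>m. theta_weight e x j * qbinom (x\<^sup>2) (2 * m + e) (m + e + j))"
    unfolding sum_distrib_left
    by (intro sum.cong refl) (simp add: E theta_weight_def power_add)
  finally show ?thesis using x by simp
qed

section \<open>Infinite products and the limit of the theta sums\<close>

text \<open>The coefficient \<open>c\<close> allows both signs to be treated at once;
  \<open>l > 0\<close> keeps the factor at \<open>i = 0\<close> away from 0.\<close>

lemma convergent_prod_one_plus_powers:
  fixes t :: real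
  assumes "\<bar>t\<bar> < 1" and "k > 0" and "l > 0" and c: "\<bar>c\<bar> \<le> 1"
  shows "convergent_prod (\<lambda>i. 1 + c * t ^ (k * i + l))"
proof (rule summable_imp_convergent_prod_real)
  have "\<bar>t\<bar> ^ k < 1" using assms by (simp add: power_less_one_iff)
  then have "summable (\<lambda>i. \<bar>c\<bar> * \<bar>t\<bar> ^ l * (\<bar>t\<bar> ^ k) ^ i)"
    by (intro summable_mult summable_geometric) simp
  then show "summable (\<lambda>i. \<bar>c * t ^ (k * i + l)\<bar>)"
    unfolding abs_mult power_abs power_add power_mult by (simp only: mult_ac)
  fix i
  have "\<bar>c * t ^ (k * i + l)\<bar> \<le> 1 * \<bar>t\<bar> ^ (k * i + l)"
    unfolding abs_mult power_abs using c by (intro mult_right_mono) auto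
  also have "\<dots> < 1" using assms by (simp add: power_less_one_iff)
  finally show "c * t ^ (k * i + l) \<noteq> - 1" by auto
qed

lemma qpoch_convergent_prod: "\<bar>t\<bar> < 1 \<Longrightarrow> convergent_prod (\<lambda>i. 1 - t ^ Suc i :: real)"
  using convergent_prod_one_plus_powers[of t 1 1 "-1"] by simp

lemma convergent_prod_LIMSEQ_lessThan:
  fixes f :: "nat \<Rightarrow> real"
  assumes "convergent_prod f"
  shows "(\<lambda>n. \<Prod>i<n. f i) \<longlonglongrightarrow> prodinf f"
  using convergent_prod_LIMSEQ[OF assms]
  by (subst filterlim_sequentially_Suc[symmetric]) (simp add: lessThan_Suc_atMost)

definition qpoch_inf :: "real \<Rightarrow> real" where
  "qpoch_inf t = (\<Prod>i. 1 - t ^ Suc i)"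

lemma qpoch_LIMSEQ: "\<bar>t\<bar> < 1 \<Longrightarrow> qpoch t \<longlonglongrightarrow> qpoch_inf t"
  using convergent_prod_LIMSEQ_lessThan[OF qpoch_convergent_prod]
  by (simp add: qpoch_def[abs_def] qpoch_inf_def)

lemma qpoch_inf_nonzero:
  assumes "\<bar>t\<bar> < 1"
  shows "qpoch_inf t \<noteq> 0"
  unfolding qpoch_inf_def using power_neq_one[OF assms]
  by (intro prodinf_nonzero qpoch_convergent_prod assms) (auto simp del: power_Suc)

lemma theta_weight_summable:
  assumes "0 < x" "x < 1"
  shows "summable (theta_weight e x)"
proof (rule summable_comparison_test')
  show "summable (\<lambda>j. 2 * x ^ j)"
    using assms by (intro summable_mult summable_geometric) auto
  fix j :: nat
  have "x ^ (j * (j + e)) \<le> x ^ j"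
    using assms by (intro power_decreasing) (cases j; auto)+
  then show "norm (theta_weight e x j) \<le> 2 * x ^ j"
    using assms zero_le_power[of x j] by (auto simp: theta_weight_def abs_mult)
qed

text \<open>For fixed \<open>j\<close> all three values of \<open>qpoch\<close> in the centred
  coefficient tend to \<open>qpoch_inf t\<close>, so the coefficient tends to its reciprocal. The
  summable theta weights supply the dominating series for Tannery's theorem.\<close>

lemma theta_sum_LIMSEQ:
  assumes t: "\<bar>t\<bar> < 1" and x: "0 < x" "x < 1"
  shows "(\<lambda>m. \<Sum>j\<le>m. theta_weight e x j * qbinom t (2 * m + e) (m + e + j))
    \<longlonglongrightarrow> (\<Sum>j. theta_weight e x j) / qpoch_inf t"
proof -
  let ?w = "theta_weight e x"
  note nz = qpoch_nonzero[OF t] and nz_inf = qpoch_inf_nonzero[OF t] and lim = qpoch_LIMSEQ[OF t]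
  \<comment> \<open>Extension by 0 beyond \<open>m\<close> turns the finite sums into series over a
    fixed index set.\<close>
  define a where "a j m = (if j \<le> m then ?w j * qbinom t (2 * m + e) (m + e + j) else 0)" for j m
  \<comment> \<open>The sequence and its inverse both converge, as the limit is nonzero; their
    bounds \<open>C\<close> and \<open>D\<close> bound all Gaussian coefficients uniformly.\<close>
  have "Bseq (qpoch t)" using lim convergentI convergent_imp_Bseq by blast
  then obtain C where C: "C > 0" "\<And>n. \<bar>qpoch t n\<bar> \<le> C" by (auto simp: Bseq_def)
  have "(\<lambda>n. inverse (qpoch t n)) \<longlonglongrightarrow> inverse (qpoch_inf t)"
    by (intro tendsto_inverse lim nz_inf)
  then have "Bseq (\<lambda>n. inverse (qpoch t n))" using convergentI convergent_imp_Bseq by blast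
  then obtain D where D: "D > 0" "\<And>n. \<bar>inverse (qpoch t n)\<bar> \<le> D" by (auto simp: Bseq_def)
  have bound: "\<bar>a j m\<bar> \<le> \<bar>?w j\<bar> * (C * (D * D))" for j m
  proof (cases "j \<le> m")
    case True
    then have "\<bar>a j m\<bar> = \<bar>?w j\<bar> * (\<bar>qpoch t (2 * m + e)\<bar> *
        (\<bar>inverse (qpoch t (m + e + j))\<bar> * \<bar>inverse (qpoch t (m - j))\<bar>))"
      by (simp add: a_def qbinom_def abs_mult divide_inverse)
    also have "\<dots> \<le> \<bar>?w j\<bar> * (C * (D * D))"
      using C D by (intro mult_left_mono mult_mono) auto
    finally show ?thesis .
  qed (use C D in \<open>simp add: a_def\<close>)
  have "((\<lambda>m. \<Sum>j. a j m) \<longlongrightarrow> (\<Sum>j. ?w j / qpoch_inf t)) sequentially"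
  proof (rule tannerys_theorem[THEN conjunct2, THEN conjunct2])
    fix j
    have 1: "(\<lambda>m. qpoch t (2 * m + e)) \<longlonglongrightarrow> qpoch_inf t"
      by (rule filterlim_compose[OF lim], rule filterlim_at_top_mono[OF filterlim_ident]) (auto intro!: always_eventually)
    have 2: "(\<lambda>m. qpoch t (m + e + j)) \<longlonglongrightarrow> qpoch_inf t"
      by (rule filterlim_compose[OF lim], rule filterlim_at_top_mono[OF filterlim_ident]) (auto intro!: always_eventually)
    have 3: "(\<lambda>m. qpoch t (m - j)) \<longlonglongrightarrow> qpoch_inf t"
      by (rule filterlim_compose[OF lim filterlim_minus_const_nat_at_top])
    have "(\<lambda>m. ?w j * (qpoch t (2 * m + e) / (qpoch t (m + e + j) * qpoch t (m - j))))
        \<longlonglongrightarrow> ?w j * (qpoch_inf t / (qpoch_inf t * qpoch_inf t))"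
      using nz_inf by (intro tendsto_mult tendsto_divide tendsto_const 1 2 3) auto
    moreover have "eventually (\<lambda>m. ?w j * (qpoch t (2 * m + e) / (qpoch t (m + e + j) * qpoch t (m - j))) = a j m) sequentially"
      using eventually_ge_at_top[of j] by eventually_elim (simp add: a_def qbinom_def)
    ultimately show "(\<lambda>m. a j m) \<longlonglongrightarrow> ?w j / qpoch_inf t"
      using nz_inf by (auto elim: Lim_transform_eventually)
  next
    show "\<forall>\<^sub>F (j, m) in at_top \<times>\<^sub>F sequentially. norm (a j m) \<le> \<bar>?w j\<bar> * (C * (D * D))"
      using bound by (intro always_eventually) auto
    have "summable (\<lambda>j. \<bar>?w j\<bar>)"
      using theta_weight_summable[OF x, of e] x by (subst abs_of_nonneg) (auto simp: theta_weight_def)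
    then show "summable (\<lambda>j. \<bar>?w j\<bar> * (C * (D * D)))"
      by (rule summable_mult2)
  qed simp
  moreover have "(\<Sum>j. a j m) = (\<Sum>j\<le>m. ?w j * qbinom t (2 * m + e) (m + e + j))" for m
    by (subst suminf_finite[of "{..m}"]) (auto simp: a_def)
  moreover have "(\<Sum>j. ?w j / qpoch_inf t) = (\<Sum>j. ?w j) / qpoch_inf t"
    by (rule suminf_divide[OF theta_weight_summable[OF x]])
  ultimately show ?thesis by simp
qed

text \<open>Two cases of Jacobi's triple product. In base \<open>x\<^sup>2\<close> the same sums
  have a limit by Tannery's theorem and another by their closed form; uniqueness of limits equates
  the two.\<close>

lemma suminf_theta_weight:
  assumes x: "0 < x" "x < 1" and e: "e \<le> 1"
  shows "(\<Sum>j. theta_weight e x j) = 2 ^ e * (\<Prod>i. 1 + x ^ (2 * i + 1 + e)) ^ 2 * qpoch_inf (x\<^sup>2)"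
proof -
  have t: "\<bar>x\<^sup>2\<bar> < 1" using x by (simp add: power_less_one_iff)
  have "convergent_prod (\<lambda>i. 1 + x ^ (2 * i + 1 + e))"
    using convergent_prod_one_plus_powers[of x 2 "1 + e" 1] x
    by (simp only: mult_1 add.assoc)
  then have "(\<lambda>m. 2 ^ e * (\<Prod>i<m. (1 + x ^ (2 * i + 1 + e))) ^ 2)
      \<longlonglongrightarrow> 2 ^ e * (\<Prod>i. 1 + x ^ (2 * i + 1 + e)) ^ 2"
    by (intro tendsto_mult tendsto_const tendsto_power convergent_prod_LIMSEQ_lessThan)
  then have "(\<Sum>j. theta_weight e x j) / qpoch_inf (x\<^sup>2) = 2 ^ e * (\<Prod>i. 1 + x ^ (2 * i + 1 + e)) ^ 2"
    using theta_sum_LIMSEQ[OF t x, of e] LIMSEQ_unique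
    unfolding finite_triple_product[OF x e] by blast
  then show ?thesis using qpoch_inf_nonzero[OF t] by (simp add: field_simps)
qed

text \<open>The theta constant comes from base \<open>x\<^sup>2\<close>, the denominator from base
  \<open>r\<close>. Merging the separate products into one requires the convergence of each of
  them.\<close>

lemma theta_sum_LIMSEQ_prod:
  fixes x r :: real
  assumes r: "\<bar>r\<bar> < 1" and x: "0 < x" "x < 1" and e: "e \<le> 1"
  defines "f \<equiv> \<lambda>i. (1 + x ^ (2 * i + 1 + e)) ^ 2 * (1 - x ^ (2 * i + 2)) / (1 - r ^ Suc i)"
  shows "convergent_prod f"
    and "(\<lambda>m. \<Sum>j\<le>m. theta_weight e x j * qbinom r (2 * m + e) (m + e + j))
      \<longlonglongrightarrow> 2 ^ e * (\<Prod>i. f i)"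
proof -
  have t: "\<bar>x\<^sup>2\<bar> < 1" using x by (simp add: power_less_one_iff)
  have 1: "convergent_prod (\<lambda>i. 1 + x ^ (2 * i + 1 + e))"
    using convergent_prod_one_plus_powers[of x 2 "1 + e" 1] x
    by (simp only: mult_1 add.assoc)
  have sq: "(x\<^sup>2) ^ Suc i = x ^ (2 * i + 2)" for i
    by (simp only: power_mult[symmetric] mult_Suc_right add.commute)
  have 2: "convergent_prod (\<lambda>i. 1 - x ^ (2 * i + 2))"
    using qpoch_convergent_prod[OF t] by (simp only: sq)
  have 3: "convergent_prod (\<lambda>i. 1 - r ^ Suc i)"
    by (rule qpoch_convergent_prod[OF r])
  note 4 = convergent_prod_power[OF 1, of 2]
  note 5 = convergent_prod_mult[OF 4 2]
  have rnz: "1 - r ^ Suc i \<noteq> 0" for i using power_neq_one[OF r, of i] by simp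
  show "convergent_prod f"
    unfolding f_def by (intro convergent_prod_divide 5 3 rnz)
  have "(\<Prod>i. f i) = (\<Prod>i. 1 + x ^ (2 * i + 1 + e)) ^ 2 * (\<Prod>i. 1 - x ^ (2 * i + 2)) / (\<Prod>i. 1 - r ^ Suc i)"
    unfolding f_def prodinf_divide[OF 5 3, symmetric] prodinf_mult[OF 4 2, symmetric] prodinf_power[OF 1] ..
  also have "(\<Prod>i. 1 - x ^ (2 * i + 2)) = qpoch_inf (x\<^sup>2)"
    by (simp only: qpoch_inf_def sq)
  finally have "2 ^ e * (\<Prod>i. f i) = (\<Sum>j. theta_weight e x j) / qpoch_inf r"
    by (simp add: suminf_theta_weight[OF x e] qpoch_inf_def)
  then show "(\<lambda>m. \<Sum>j\<le>m. theta_weight e x j * qbinom r (2 * m + e) (m + e + j))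
      \<longlonglongrightarrow> 2 ^ e * (\<Prod>i. f i)"
    using theta_sum_LIMSEQ[OF r x, of e] by simp
qed

text \<open>\<open>n div 2\<close> tends to infinity with \<open>n\<close>, and
  \<open>n = 2 * (n div 2) + e\<close> on the residue class. This passes from a limit in
  \<open>m\<close> to a limit over even or odd \<open>n\<close>.\<close>

lemma tendsto_mod_2I:
  fixes f :: "nat \<Rightarrow> 'b :: topological_space"
  assumes "(\<lambda>m. f (2 * m + e)) \<longlonglongrightarrow> L"
  shows "(f \<longlongrightarrow> L) (inf at_top (principal {n. n mod 2 = e}))"
proof (rule topological_tendstoI)
  fix S assume "open S" "L \<in> S"
  with assms have "eventually (\<lambda>m. f (2 * m + e) \<in> S) sequentially"
    by (rule topological_tendstoD)
  moreover have "filterlim (\<lambda>n :: nat. n div 2) at_top at_top"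
    by (rule filterlim_at_top_div_const_nat) simp
  ultimately have "eventually (\<lambda>n. f (2 * (n div 2) + e) \<in> S) sequentially"
    by (rule eventually_compose_filterlim)
  then show "eventually (\<lambda>n. f n \<in> S) (inf at_top (principal {n. n mod 2 = e}))"
    unfolding eventually_inf_principal
  proof eventually_elim
    case (elim n)
    show ?case
    proof
      assume "n \<in> {n. n mod 2 = e}"
      then have "2 * (n div 2) + e = n" using mult_div_mod_eq[of 2 n] by simp
      with elim show "f n \<in> S" by simp
    qed
  qed
qed

subsection \<open>Hermitian forms over finite fields\<close>

text \<open>Multiplication by a nonzero \<open>x\<close> permutes the nonzero elements; comparing
  the products over them gives \<open>x ^ card (-{0}) = 1\<close>.\<close>

lemma finite_field_power_card:
  fixes x :: "'a :: {field, finite}"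
  shows "x ^ CARD('a) = x"
proof (cases "x = 0")
  case False
  have "(\<Prod>y\<in>-{0}. y) = (\<Prod>y\<in>-{0}. x * y)"
    by (rule prod.reindex_bij_witness[of _ "\<lambda>y. x * y" "\<lambda>y. y / x"]) (use False in auto)
  also have "\<dots> = x ^ card (-{0 :: 'a}) * (\<Prod>y\<in>-{0}. y)"
    by (simp add: prod.distrib)
  finally have "x ^ card (-{0 :: 'a}) = 1"
    by simp
  moreover have "CARD('a) = Suc (card (-{0 :: 'a}))"
    by (simp add: Compl_eq_Diff_UNIV card_Suc_Diff1)
  ultimately show ?thesis
    by simp
qed simp

lemma card_power_eq_le:
  fixes a :: "'a :: field"
  assumes "n > 0"
  shows "finite {x. x ^ n = a}" "card {x. x ^ n = a} \<le> n"
proof -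
  let ?p = "Polynomial.monom 1 n + [:- a:]"
  have p: "Polynomial.degree ?p = n" "?p \<noteq> 0"
  proof -
    have "Polynomial.coeff ?p n = 1" using assms by (simp add: coeff_pCons split: nat.splits)
    then show "?p \<noteq> 0" by force
    show "Polynomial.degree ?p = n"
      using assms degree_add_eq_left[of "[:- a:]" "Polynomial.monom 1 n"]
      by (simp add: degree_monom_eq)
  qed
  have eq: "{x. x ^ n = a} = {x. poly ?p x = 0}"
    by (auto simp: poly_monom)
  show "finite {x. x ^ n = a}" "card {x. x ^ n = a} \<le> n"
    unfolding eq using poly_roots_finite[OF p(2)] card_poly_roots_bound[OF p(2)] p(1) by auto
qed

section \<open>Conjugation and norms in the field with q^2 elements\<close>

locale hermitian_field =
  fixes q :: nat and field_type :: "'a :: {field, finite} itself"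
  assumes primepow_q: "primepow q" and odd_q: "odd q" and card_field: "CARD('a) = q ^ 2"
begin

lemma q_gt_2: "q > 2"
proof -
  have "q \<ge> 2" using primepow_gt_Suc_0[OF primepow_q] by linarith
  with odd_q show ?thesis by (cases "q = 2") auto
qed

text \<open>The characteristic divides the order of the field, hence is the prime of which
  \<open>q\<close> is a power. So conjugation is an iterate of the Frobenius map and is
  additive.\<close>

lemma CHAR_power_q: "\<exists>k. q = CHAR('a) ^ k" and prime_CHAR_field: "prime CHAR('a)"
proof -
  show pr: "prime CHAR('a)"
    by (rule prime_CHAR_semidom) (simp add: finite_imp_CHAR_pos)
  obtain p k where pk: "prime p" "q = p ^ k" "k > 0"
    using primepow_q by (auto simp: primepow_def)
  have "CHAR('a) dvd (p ^ k) ^ 2"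
    using CHAR_dvd_CARD[where ?'a = 'a] card_field pk by simp
  then have "CHAR('a) dvd p"
    using pr prime_dvd_power by blast
  then have "CHAR('a) = p"
    using pr pk(1) by (simp add: primes_dvd_imp_eq)
  with pk show "\<exists>k. q = CHAR('a) ^ k" by auto
qed

lemma conj_add: "(x + y :: 'a) ^ q = x ^ q + y ^ q"
  using CHAR_power_q freshmans_dream'[OF prime_CHAR_field] by blast

lemma conj_minus: "(- x :: 'a) ^ q = - (x ^ q)"
  using odd_q by simp

lemma conj_diff: "(x - y :: 'a) ^ q = x ^ q - y ^ q"
  using conj_add[of x "- y"] by (simp add: conj_minus)

lemma conj_conj: "((x :: 'a) ^ q) ^ q = x"
  using finite_field_power_card[of x] card_field by (simp add: power2_eq_square power_mult)

lemma conj_sum: "(\<Sum>i\<in>A. f i :: 'a) ^ q = (\<Sum>i\<in>A. f i ^ q)"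
  using CHAR_power_q freshmans_dream_sum'[OF prime_CHAR_field] by blast

text \<open>Makes the general facts about ring homomorphisms applied to matrices available for the
  adjoint.\<close>

sublocale conj: comm_ring_hom "\<lambda>x :: 'a. x ^ q"
  by unfold_locales (use q_gt_2 in \<open>auto simp: conj_add conj_minus power_mult_distrib\<close>)

lemma two_neq_0: "(2 :: 'a) \<noteq> 0"
proof
  assume "(2 :: 'a) = 0"
  then have "of_nat 2 = (0 :: 'a)" by simp
  then have "CHAR('a) dvd 2"
    using of_nat_eq_0_iff_char_dvd by blast
  then have "CHAR('a) = 2"
    using prime_CHAR_field by (simp add: primes_dvd_imp_eq)
  then have "q = 1" using CHAR_power_q odd_q by auto
  then show False using q_gt_2 by simp
qed

text \<open>Otherwise all \<open>q ^ 2 - 1\<close> nonzero elements would be roots of X^(q - 1) -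
  1.\<close>

lemma ex_not_fixed: "\<exists>x :: 'a. x ^ q \<noteq> x"
proof (rule ccontr)
  assume *: "\<nexists>x :: 'a. x ^ q \<noteq> x"
  have "x ^ (q - 1) = 1" if "x \<noteq> 0" for x :: 'a
    using * that power_Suc[of x "q - 1"] q_gt_2 by (auto simp: Suc_diff_1)
  then have "-{0} \<subseteq> {x :: 'a. x ^ (q - 1) = 1}" by auto
  then have "card (-{0 :: 'a}) \<le> card {x :: 'a. x ^ (q - 1) = 1}"
    by (intro card_mono) auto
  also have "\<dots> \<le> q - 1"
    using q_gt_2 by (intro card_power_eq_le) auto
  finally have "q ^ 2 - 1 \<le> q - 1"
    by (simp add: Compl_eq_Diff_UNIV card_Diff_singleton card_field)
  moreover have "q ^ 2 > q" using q_gt_2 by (simp add: power2_eq_square)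
  ultimately show False using q_gt_2 by linarith
qed

text \<open>The \<open>q\<^sup>2 - 1\<close> nonzero elements have norms among the at most \<open>q - 1\<close> nonzero elements fixed by
  conjugation, and each norm is taken at most \<open>q + 1\<close> times, so all these bounds are attained.\<close>
lemma card_norm_eq:
  fixes a :: 'a
  assumes "a \<noteq> 0" and "a ^ q = a"
  shows "card {x. x ^ (q + 1) = a} = q + 1"
proof (rule ccontr)
  let ?K = "{b :: 'a. b ^ (q - 1) = 1}" and ?F = "\<lambda>b :: 'a. {x. x ^ (q + 1) = b}"
  assume neq: "card (?F a) \<noteq> q + 1"
  have le: "card (?F b) \<le> q + 1" for b
    by (rule card_power_eq_le) simp
  have exp: "(q + 1) * (q - 1) + 1 = q ^ 2"
    using q_gt_2 by (simp add: algebra_simps power2_eq_square diff_mult_distrib2)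
  have nz: "b \<noteq> 0" if "b \<in> ?K" for b
    using that q_gt_2 by (auto simp: power_0_left)
  have aK: "a \<in> ?K"
    using assms power_Suc[of a "q - 1"] q_gt_2 by (auto simp: Suc_diff_1)
  have "-{0} \<subseteq> (\<Union>b\<in>?K. ?F b)"
  proof
    fix x :: 'a assume x: "x \<in> -{0}"
    have "x * x ^ ((q + 1) * (q - 1)) = x"
      using finite_field_power_card[of x] by (simp add: card_field exp [symmetric])
    then have "x ^ ((q + 1) * (q - 1)) = 1" using x by simp
    then show "x \<in> (\<Union>b\<in>?K. ?F b)"
      by (simp only: power_mult) auto
  qed
  then have "card (-{0 :: 'a}) \<le> card (\<Union>b\<in>?K. ?F b)"
    by (intro card_mono) auto
  also have "\<dots> \<le> (\<Sum>b\<in>?K. card (?F b))"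
    by (rule card_UN_le) simp
  also have "\<dots> < (\<Sum>b\<in>?K. q + 1)"
    using le aK neq by (intro sum_strict_mono_ex1) (auto intro: le_neq_trans)
  also have "\<dots> = card ?K * (q + 1)" by simp
  also have "\<dots> \<le> (q - 1) * (q + 1)"
    using q_gt_2 by (intro mult_right_mono card_power_eq_le) auto
  finally show False
    using exp by (simp add: Compl_eq_Diff_UNIV card_Diff_singleton card_field mult.commute)
qed

lemma ex_norm_eq:
  fixes a :: 'a
  assumes "a \<noteq> 0" and "a ^ q = a"
  shows "\<exists>x. x ^ (q + 1) = a"
proof -
  have "{x. x ^ (q + 1) = a} \<noteq> {}"
    using card_norm_eq[OF assms] by force
  then show ?thesis by auto
qed

section \<open>The standard Hermitian form and its unit vectors\<close>

abbreviation form :: "'a vec \<Rightarrow> 'a vec \<Rightarrow> 'a" where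
  "form \<equiv> hermitian_form q"

lemma form_conj:
  assumes "v \<in> carrier_vec n" "w \<in> carrier_vec n"
  shows "form v w ^ q = form w v"
  using assms by (simp add: hermitian_form_def conj_sum power_mult_distrib conj_conj mult.commute)

lemma form_self_conj: "form v v ^ q = form v v"
  by (rule form_conj[where n = "dim_vec v"]) auto

lemma form_vCons: "form (vCons x v) (vCons y w) = x * y ^ q + form v w"
  by (simp add: hermitian_form_def sum.lessThan_Suc_shift del: sum.lessThan_Suc)

lemma form_add_left:
  assumes "v \<in> carrier_vec n" "w \<in> carrier_vec n"
  shows "form (v + w) u = form v u + form w u"
  using assms by (simp add: hermitian_form_def distrib_right sum.distrib)

lemma form_add_right:
  assumes "u \<in> carrier_vec n" "v \<in> carrier_vec n" "w \<in> carrier_vec n"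
  shows "form u (v + w) = form u v + form u w"
  using assms by (simp add: hermitian_form_def distrib_left sum.distrib conj_add)

lemma form_smult_left: "form (c \<cdot>\<^sub>v v) w = c * form v w"
  by (simp add: hermitian_form_def sum_distrib_left mult.assoc)

lemma form_smult_right:
  assumes "v \<in> carrier_vec n" "w \<in> carrier_vec n"
  shows "form v (c \<cdot>\<^sub>v w) = c ^ q * form v w"
  using assms by (simp add: hermitian_form_def sum_distrib_left power_mult_distrib mult_ac)

lemma carrier_vec_Suc_eq: "carrier_vec (Suc n) = (\<lambda>(x, v). vCons x v) ` (UNIV \<times> carrier_vec n)"
proof (intro equalityI subsetI)
  fix v :: "'b vec" assume "v \<in> carrier_vec (Suc n)"
  then show "v \<in> (\<lambda>(x, v). vCons x v) ` (UNIV \<times> carrier_vec n)"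
    by (cases v) (auto simp: image_iff)
qed auto

lemma card_carrier_vec: "finite (carrier_vec n :: 'a vec set)"
    "card (carrier_vec n :: 'a vec set) = q ^ (2 * n)"
proof -
  have "finite (carrier_vec n :: 'a vec set) \<and> card (carrier_vec n :: 'a vec set) = q ^ (2 * n)"
  proof (induction n)
    case 0
    have "carrier_vec 0 = {vNil :: 'a vec}" by auto
    then show ?case by simp
  next
    case (Suc n)
    have "inj_on (\<lambda>(x, v). vCons x v) (UNIV \<times> carrier_vec n :: ('a \<times> 'a vec) set)"
      by (auto simp: inj_on_def)
    with Suc show ?case
      by (simp add: carrier_vec_Suc_eq card_image card_cartesian_product card_field power2_eq_square)
  qed
  then show "finite (carrier_vec n :: 'a vec set)"
    "card (carrier_vec n :: 'a vec set) = q ^ (2 * n)" by auto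
qed

definition unit_vectors :: "nat \<Rightarrow> 'a vec set" where
  "unit_vectors n = {v \<in> carrier_vec n. form v v = 1}"

text \<open>Given the remaining coordinates \<open>v\<close>, the first one must have norm
  \<open>1 - form v v\<close>: there is one choice if this is 0 and there are \<open>q + 1\<close>
  otherwise. The additive form avoids natural subtraction.\<close>

lemma card_unit_vectors_Suc:
  "card (unit_vectors (Suc n)) + q * card (unit_vectors n) = (q + 1) * q ^ (2 * n)"
proof -
  let ?V = "carrier_vec n :: 'a vec set"
  have "unit_vectors (Suc n) = (\<lambda>(v, x). vCons x v) ` (SIGMA v:?V. {x. x ^ (q + 1) = 1 - form v v})"
    by (auto simp: unit_vectors_def carrier_vec_Suc_eq form_vCons image_iff algebra_simps)
  moreover have "inj_on (\<lambda>(v, x). vCons x v) (SIGMA v:?V. {x. x ^ (q + 1) = 1 - form v v})"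
    by (auto simp: inj_on_def)
  ultimately have "card (unit_vectors (Suc n)) = (\<Sum>v\<in>?V. card {x. x ^ (q + 1) = 1 - form v v})"
    by (simp add: card_image card_SigmaI card_carrier_vec)
  also have "\<dots> = (\<Sum>v\<in>?V. if form v v = 1 then 1 else q + 1)"
  proof (intro sum.cong refl)
    fix v :: "'a vec" assume "v \<in> ?V"
    have "{x :: 'a. x ^ (q + 1) = 0} = {0}" by auto
    moreover have "card {x. x ^ (q + 1) = 1 - form v v} = q + 1" if "form v v \<noteq> 1"
      using that by (intro card_norm_eq) (auto simp: conj_diff form_self_conj)
    ultimately show "card {x. x ^ (q + 1) = 1 - form v v} = (if form v v = 1 then 1 else q + 1)"
      by simp
  qed
  finally have "card (unit_vectors (Suc n)) + q * card (unit_vectors n)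
      = (\<Sum>v\<in>?V. if form v v = 1 then 1 else q + 1) + (\<Sum>v\<in>?V. if form v v = 1 then q else 0)"
    by (simp add: unit_vectors_def sum.If_cases card_carrier_vec Int_def conj_commute)
  also have "\<dots> = (\<Sum>v\<in>?V. q + 1)"
    unfolding sum.distrib[symmetric] by (intro sum.cong) auto
  finally show ?thesis by (simp add: card_carrier_vec)
qed

text \<open>Solves the recurrence from the empty set at \<open>n = 0\<close>; the factor
  \<open>q\<close> on the left avoids the exponent 2n - 1.\<close>

lemma card_unit_vectors:
  "real q * real (card (unit_vectors n)) = real q ^ (2 * n) * (1 - (- 1 / real q) ^ n)"
proof (induction n)
  case 0
  have "unit_vectors 0 = {}" by (auto simp: unit_vectors_def hermitian_form_def)
  then show ?case by simp
next
  case (Suc n)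
  have "real q * real (card (unit_vectors (Suc n)))
      = real q * (real q + 1) * real q ^ (2 * n) - real q * (real q * real (card (unit_vectors n)))"
    using arg_cong[OF card_unit_vectors_Suc, of "\<lambda>x. real q * real x" n] by (simp add: algebra_simps)
  also have "\<dots> = real q ^ (2 * Suc n) * (1 - (- 1 / real q) ^ Suc n)"
    unfolding Suc using q_gt_2 by (simp add: field_simps power2_eq_square)
  finally show ?case .
qed

subsection \<open>Frames, projections and unitary involutions\<close>

definition adj :: "'a mat \<Rightarrow> 'a mat" where
  "adj A = map_mat (\<lambda>x. x ^ q) (transpose_mat A)"

lemma adj_carrier [simp]: "adj A \<in> carrier_mat m n \<longleftrightarrow> A \<in> carrier_mat n m"
  by (auto simp: adj_def)

lemma adj_adj [simp]: "adj (adj A) = A"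
  by (rule eq_matI) (auto simp: adj_def conj_conj)

lemma adj_mult:
  assumes "A \<in> carrier_mat n m" "B \<in> carrier_mat m k"
  shows "adj (A * B) = adj B * adj A"
  using assms by (simp add: adj_def transpose_mult[OF assms] conj.mat_hom_mult[where n = m])

lemma adj_one [simp]: "adj (1\<^sub>m n) = 1\<^sub>m n"
  by (rule eq_matI) (use q_gt_2 in \<open>auto simp: adj_def\<close>)

lemma adj_minus:
  assumes "A \<in> carrier_mat n m" "B \<in> carrier_mat n m"
  shows "adj (A - B) = adj A - adj B"
  by (rule eq_matI) (use assms in \<open>auto simp: adj_def conj_diff\<close>)

lemma mult_unit_vec:
  fixes A :: "'a mat"
  assumes "A \<in> carrier_mat n m" "j < m"
  shows "A *\<^sub>v unit_vec m j = col A j"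
  using assms col_mult2[of A n m "1\<^sub>m m" m j] by simp

text \<open>The columns appear in reversed order because \<open>form\<close> conjugates its second
  argument while \<open>adj\<close> conjugates the entries of \<open>A\<close>.\<close>

lemma adj_mult_index:
  assumes "A \<in> carrier_mat n m" "B \<in> carrier_mat n k" "i < m" "j < k"
  shows "(adj A * B) $$ (i, j) = form (col B j) (col A i)"
  using assms by (auto simp: adj_def hermitian_form_def scalar_prod_def lessThan_atLeast0 mult.commute)

lemma adj_mult_vec_index:
  assumes "A \<in> carrier_mat n m" "v \<in> carrier_vec n" "i < m"
  shows "(adj A *\<^sub>v v) $ i = form v (col A i)"
  using assms by (auto simp: adj_def hermitian_form_def scalar_prod_def lessThan_atLeast0 mult.commute)

lemma form_mult_left:
  assumes "A \<in> carrier_mat n m" "v \<in> carrier_vec m" "w \<in> carrier_vec n"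
  shows "form (A *\<^sub>v v) w = form v (adj A *\<^sub>v w)"
proof -
  have *: "form x y = x \<bullet> map_vec (\<lambda>x. x ^ q) y" if "dim_vec x = dim_vec y" for x y :: "'a vec"
    using that by (simp add: hermitian_form_def scalar_prod_def lessThan_atLeast0)
  have "map_vec (\<lambda>x. x ^ q) (adj A *\<^sub>v w) = transpose_mat A *\<^sub>v map_vec (\<lambda>x. x ^ q) w"
    using assms adj_carrier[of A n m, THEN iffD2]
    by (intro eq_vecI) (auto simp: adj_def scalar_prod_def conj_sum power_mult_distrib conj_conj)
  moreover have "(A *\<^sub>v v) \<bullet> map_vec (\<lambda>x. x ^ q) w = v \<bullet> (transpose_mat A *\<^sub>v map_vec (\<lambda>x. x ^ q) w)"
    using assms transpose_vec_mult_scalar[of A n m v "map_vec (\<lambda>x. x ^ q) w"]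
    by (metis comm_scalar_prod map_carrier_vec mult_mat_vec_carrier transpose_carrier_mat)
  ultimately show ?thesis using assms by (simp add: * adj_def)
qed

definition frames :: "nat \<Rightarrow> nat \<Rightarrow> 'a mat set" where
  "frames n m = {B \<in> carrier_mat n m. adj B * B = 1\<^sub>m m}"

definition projections :: "nat \<Rightarrow> 'a mat set" where
  "projections n = {P \<in> carrier_mat n n. adj P = P \<and> P * P = P}"

lemma frames_iff:
  "B \<in> frames n m \<longleftrightarrow> B \<in> carrier_mat n m \<and>
     (\<forall>i<m. \<forall>j<m. form (col B i) (col B j) = (if i = j then 1 else 0))"
proof -
  have "adj B * B = 1\<^sub>m m \<longleftrightarrow> (\<forall>i<m. \<forall>j<m. form (col B i) (col B j) = (if i = j then 1 else 0))"
    if B: "B \<in> carrier_mat n m"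
  proof -
    have dims: "dim_row (adj B * B) = m" "dim_col (adj B * B) = m"
      using B by (auto simp: adj_def)
    show ?thesis
      by (auto simp: mat_eq_iff dims adj_mult_index[OF B B] simp del: index_mult_mat)
  qed
  then show ?thesis by (auto simp: frames_def)
qed

lemma finite_carrier_mat: "finite (carrier_mat n m :: 'a mat set)"
proof -
  have "inj_on cols (carrier_mat n m :: 'a mat set)"
    by (auto simp: inj_on_def) (metis carrier_matD(1) mat_of_cols_cols)
  moreover have "finite {vs. set vs \<subseteq> (carrier_vec n :: 'a vec set) \<and> length vs = m}"
    by (rule finite_lists_length_eq) (rule card_carrier_vec)
  moreover have "cols ` (carrier_mat n m :: 'a mat set) \<subseteq> {vs. set vs \<subseteq> carrier_vec n \<and> length vs = m}"
    using cols_dim by fastforce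
  ultimately show ?thesis
    using finite_imageD finite_subset by blast
qed

lemma finite_frames: "finite (frames n m)"
  using finite_carrier_mat by (auto simp: frames_def)

text \<open>Testing the isometry on unit vectors shows that the columns are orthonormal. Conversely
  the left inverse \<open>adj A\<close> of a square matrix is two-sided, and adjointness gives the
  isometry.\<close>

lemma unitary_group_eq_frames: "unitary_group n q = frames n n"
proof (intro equalityI subsetI)
  fix A :: "'a mat" assume "A \<in> unitary_group n q"
  then have A: "A \<in> carrier_mat n n"
    and iso: "\<And>v w. v \<in> carrier_vec n \<Longrightarrow> w \<in> carrier_vec n \<Longrightarrow> form (A *\<^sub>v v) (A *\<^sub>v w) = form v w"
    by (auto simp: unitary_group_def general_linear_group_def)
  have "form (col A i) (col A j) = (if i = j then 1 else 0)" if "i < n" "j < n" for i j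
  proof -
    have "form (col A i) (col A j) = form (unit_vec n i) (unit_vec n j)"
      using that iso[of "unit_vec n i" "unit_vec n j"] A by (simp add: mult_unit_vec[of A n n])
    also have "\<dots> = form (col (1\<^sub>m n) i) (col (1\<^sub>m n) j)" using that by simp
    also have "\<dots> = (if i = j then 1 else 0)"
      using that adj_mult_index[of "1\<^sub>m n" n n "1\<^sub>m n" n j i] by auto
    finally show ?thesis .
  qed
  with A show "A \<in> frames n n" by (simp add: frames_iff)
next
  fix A :: "'a mat" assume "A \<in> frames n n"
  then have A: "A \<in> carrier_mat n n" "adj A * A = 1\<^sub>m n" by (auto simp: frames_def)
  have "A * adj A = 1\<^sub>m n"
    using A mat_mult_left_right_inverse[of "adj A" n A] by simp
  with A have "inverts_mat A (adj A)" "inverts_mat (adj A) A"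
    using adj_carrier[of A n n] by (auto simp: inverts_mat_def simp del: adj_carrier)
  with A have "invertible_mat A"
    unfolding invertible_mat_def by auto
  moreover have "form (A *\<^sub>v v) (A *\<^sub>v w) = form v w" if "v \<in> carrier_vec n" "w \<in> carrier_vec n" for v w
  proof -
    have "form (A *\<^sub>v v) (A *\<^sub>v w) = form v (adj A *\<^sub>v (A *\<^sub>v w))"
      using that A by (intro form_mult_left[of _ n n]) auto
    also have "adj A *\<^sub>v (A *\<^sub>v w) = (adj A * A) *\<^sub>v w"
      using that A by (subst assoc_mult_mat_vec[of _ n n _ n]) auto
    finally show ?thesis using that A by simp
  qed
  ultimately show "A \<in> unitary_group n q"
    using A by (auto simp: unitary_group_def general_linear_group_def)
qed

lemma smult_smult_mat: "a \<cdot>\<^sub>m (b \<cdot>\<^sub>m X) = (a * b :: 'a) \<cdot>\<^sub>m X"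
  by (rule eq_matI) auto

text \<open>For \<open>A = 1 - 2P\<close>, \<open>A\<close> squares to the identity exactly if
  \<open>P\<close> is idempotent, as 2 is invertible. Among such \<open>A\<close>, the unitary ones
  are the self-adjoint ones.\<close>

lemma bij_betw_involutions_projections:
  "bij_betw (\<lambda>P. 1\<^sub>m n - (2 :: 'a) \<cdot>\<^sub>m P) (projections n) {A \<in> unitary_group n q. A * A = 1\<^sub>m n}"
proof (rule bij_betw_byWitness[where f' = "\<lambda>A. (1 / 2 :: 'a) \<cdot>\<^sub>m (1\<^sub>m n - A)"])
  have adj_smult: "adj (2 \<cdot>\<^sub>m X) = 2 \<cdot>\<^sub>m adj X" "adj ((1/2) \<cdot>\<^sub>m X) = (1/2) \<cdot>\<^sub>m adj X" for X
  proof -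
    have 2: "(2 :: 'a) ^ q = 2"
      using conj.hom_add[of 1 1] by simp
    then have "(1 / 2 :: 'a) ^ q = 1 / 2" by (simp add: power_divide)
    with 2 show "adj (2 \<cdot>\<^sub>m X) = 2 \<cdot>\<^sub>m adj X" "adj ((1/2) \<cdot>\<^sub>m X) = (1/2) \<cdot>\<^sub>m adj X"
      by (auto simp: adj_def power_mult_distrib power_divide intro!: eq_matI)
  qed
  show "\<forall>P\<in>projections n. (1 / 2) \<cdot>\<^sub>m (1\<^sub>m n - (1\<^sub>m n - 2 \<cdot>\<^sub>m P)) = P"
    using two_neq_0 by (auto simp: projections_def intro!: eq_matI)
  show "\<forall>A\<in>{A \<in> unitary_group n q. A * A = 1\<^sub>m n}. 1\<^sub>m n - 2 \<cdot>\<^sub>m ((1 / 2 :: 'a) \<cdot>\<^sub>m (1\<^sub>m n - A)) = A"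
  proof clarify
    fix A :: "'a mat" assume "A \<in> unitary_group n q"
    then have "A \<in> carrier_mat n n"
      by (simp add: unitary_group_eq_frames frames_def)
    then show "1\<^sub>m n - 2 \<cdot>\<^sub>m ((1 / 2 :: 'a) \<cdot>\<^sub>m (1\<^sub>m n - A)) = A"
      using two_neq_0 by (intro eq_matI) (auto simp: diff_divide_distrib)
  qed
  show "(\<lambda>P. 1\<^sub>m n - 2 \<cdot>\<^sub>m P) ` projections n \<subseteq> {A \<in> unitary_group n q. A * A = 1\<^sub>m n}"
  proof clarsimp
    fix P assume "P \<in> projections n"
    then have P: "P \<in> carrier_mat n n" "adj P = P" "P * P = P"
      by (auto simp: projections_def)
    let ?A = "1\<^sub>m n - 2 \<cdot>\<^sub>m P"
    have A: "?A \<in> carrier_mat n n" using P by (simp add: minus_carrier_mat)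
    have "?A * ?A = ?A * 1\<^sub>m n - ?A * (2 \<cdot>\<^sub>m P)"
      using P A by (intro mult_minus_distrib_mat) auto
    also have "?A * (2 \<cdot>\<^sub>m P) = 1\<^sub>m n * (2 \<cdot>\<^sub>m P) - (2 \<cdot>\<^sub>m P) * (2 \<cdot>\<^sub>m P)"
      using P by (intro minus_mult_distrib_mat) auto
    also have "(2 \<cdot>\<^sub>m P) * (2 \<cdot>\<^sub>m P) = (2 * 2) \<cdot>\<^sub>m P"
      using P by (simp add: mult_smult_assoc_mat[of _ n n _ n] mult_smult_distrib[of _ n n _ n] smult_smult_mat)
    finally have "?A * ?A = 1\<^sub>m n"
      using P A by (auto intro!: eq_matI)
    moreover have "adj ?A = ?A"
      using P by (simp add: adj_minus[of _ n n] adj_smult)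
    ultimately show "?A \<in> unitary_group n q \<and> ?A * ?A = 1\<^sub>m n"
      using A by (simp add: unitary_group_eq_frames frames_def)
  qed
  show "(\<lambda>A. (1 / 2) \<cdot>\<^sub>m (1\<^sub>m n - A)) ` {A \<in> unitary_group n q. A * A = 1\<^sub>m n} \<subseteq> projections n"
  proof clarsimp
    fix A :: "'a mat" assume A': "A \<in> unitary_group n q" "A * A = 1\<^sub>m n"
    then have A: "A \<in> carrier_mat n n" "adj A * A = 1\<^sub>m n" "adj A \<in> carrier_mat n n"
      by (auto simp: unitary_group_eq_frames frames_def)
    \<comment> \<open>Inserting \<open>A * A\<close>, which is the identity, shows that a unitary
      involution is self-adjoint.\<close>
    have "adj A = adj A * (A * A)" using A A'(2) by simp
    also have "\<dots> = (adj A * A) * A" using A by (intro assoc_mult_mat[symmetric]) auto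
    finally have adjA: "adj A = A" using A by simp
    let ?M = "1\<^sub>m n - A"
    have M: "?M \<in> carrier_mat n n" using A by (simp add: minus_carrier_mat)
    have "?M * ?M = ?M * 1\<^sub>m n - ?M * A"
      using M A by (intro mult_minus_distrib_mat) auto
    also have "?M * A = 1\<^sub>m n * A - A * A"
      using A by (intro minus_mult_distrib_mat) auto
    finally have MM: "?M * ?M = 2 \<cdot>\<^sub>m ?M"
      using A A'(2) by (auto intro!: eq_matI)
    have "((1 / 2) \<cdot>\<^sub>m ?M) * ((1 / 2) \<cdot>\<^sub>m ?M) = (1 / 2 * (1 / 2)) \<cdot>\<^sub>m (?M * ?M)"
      using M by (simp add: mult_smult_assoc_mat[of _ n n _ n] mult_smult_distrib[of _ n n _ n] smult_smult_mat)
    also have "\<dots> = (1 / 2) \<cdot>\<^sub>m ?M"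
      unfolding MM smult_smult_mat mult.assoc[of "1 / 2"] using two_neq_0 by simp
    finally have "((1 / 2) \<cdot>\<^sub>m ?M) * ((1 / 2) \<cdot>\<^sub>m ?M) = (1 / 2) \<cdot>\<^sub>m ?M" .
    moreover have "adj ((1 / 2) \<cdot>\<^sub>m ?M) = (1 / 2) \<cdot>\<^sub>m ?M"
      using A by (simp add: adj_smult adj_minus[of _ n n] adjA)
    ultimately show "(1 / 2) \<cdot>\<^sub>m ?M \<in> projections n"
      using M by (simp add: projections_def)
  qed
qed

lemma num_involutions_eq_card_projections: "num_involutions_U TYPE('a) n q = card (projections n)"
  unfolding num_involutions_U_def using bij_betw_same_card[OF bij_betw_involutions_projections] by simp

section \<open>Frames up to unitary change of basis\<close>

lemma frame_mult_adj_projection: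
  assumes "B \<in> frames n m"
  shows "B * adj B \<in> projections n"
proof -
  have B: "B \<in> carrier_mat n m" "adj B \<in> carrier_mat m n" "adj B * B = 1\<^sub>m m"
    using assms by (auto simp: frames_def)
  have "(B * adj B) * (B * adj B) = B * (adj B * (B * adj B))"
    using B by (intro assoc_mult_mat) auto
  also have "adj B * (B * adj B) = (adj B * B) * adj B"
    using B by (intro assoc_mult_mat[symmetric]) auto
  finally have "(B * adj B) * (B * adj B) = B * adj B" using B by simp
  then show ?thesis
    using B by (simp add: projections_def adj_mult[of _ n m _ n])
qed

lemma frame_mult_vec_inverse:
  assumes "B \<in> frames n m" "c \<in> carrier_vec m"
  shows "adj B *\<^sub>v (B *\<^sub>v c) = c"
proof -
  have B: "B \<in> carrier_mat n m" "adj B \<in> carrier_mat m n" "adj B * B = 1\<^sub>m m"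
    using assms by (auto simp: frames_def)
  have "adj B *\<^sub>v (B *\<^sub>v c) = (adj B * B) *\<^sub>v c"
    using B assms by (intro assoc_mult_mat_vec[symmetric]) auto
  with B assms show ?thesis by simp
qed

lemma frame_inj_on:
  assumes "B \<in> frames n m"
  shows "inj_on (\<lambda>c. B *\<^sub>v c) (carrier_vec m)"
  using frame_mult_vec_inverse[OF assms] by (intro inj_on_inverseI)

lemma frame_form:
  assumes "B \<in> frames n m" "c \<in> carrier_vec m" "d \<in> carrier_vec m"
  shows "form (B *\<^sub>v c) (B *\<^sub>v d) = form c d"
proof -
  have "B \<in> carrier_mat n m" using assms by (simp add: frames_def)
  then show ?thesis
    using assms by (simp add: form_mult_left[of B n m] frame_mult_vec_inverse[OF assms(1)])
qed

text \<open>A frame embeds \<open>carrier_vec m\<close> into \<open>carrier_vec n\<close>; counting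
  vectors takes the place of a dimension argument.\<close>

lemma frames_le:
  assumes "B \<in> frames n m"
  shows "m \<le> n"
proof -
  have "(\<lambda>c. B *\<^sub>v c) ` carrier_vec m \<subseteq> carrier_vec n"
    using assms by (auto simp: frames_def intro!: mult_mat_vec_carrier)
  then have "card (carrier_vec m :: 'a vec set) \<le> card (carrier_vec n :: 'a vec set)"
    using card_inj_on_le[OF frame_inj_on[OF assms]] card_carrier_vec by blast
  then show ?thesis using q_gt_2 by (simp add: card_carrier_vec)
qed

text \<open>\<open>B * adj B\<close> has the same range as \<open>B\<close>, and \<open>B\<close> is
  injective. The size of the range thus serves as the rank and separates projections of different
  rank.\<close>

lemma card_range_frame_projection:
  assumes "B \<in> frames n m"
  shows "card ((\<lambda>v. (B * adj B) *\<^sub>v v) ` carrier_vec n) = q ^ (2 * m)"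
proof -
  have B: "B \<in> carrier_mat n m" "adj B \<in> carrier_mat m n"
    using assms by (auto simp: frames_def)
  have assoc: "(B * adj B) *\<^sub>v v = B *\<^sub>v (adj B *\<^sub>v v)" if "v \<in> carrier_vec n" for v
    using B that by (intro assoc_mult_mat_vec) auto
  have "(\<lambda>v. (B * adj B) *\<^sub>v v) ` carrier_vec n = (\<lambda>c. B *\<^sub>v c) ` carrier_vec m"
  proof (intro equalityI image_subsetI)
    fix v :: "'a vec" assume "v \<in> carrier_vec n"
    with B show "(B * adj B) *\<^sub>v v \<in> (\<lambda>c. B *\<^sub>v c) ` carrier_vec m"
      by (auto simp: assoc intro!: imageI mult_mat_vec_carrier)
  next
    fix c :: "'a vec" assume c: "c \<in> carrier_vec m"
    then have "B *\<^sub>v c = (B * adj B) *\<^sub>v (B *\<^sub>v c)"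
      using B by (simp add: assoc frame_mult_vec_inverse[OF assms])
    with B c show "B *\<^sub>v c \<in> (\<lambda>v. (B * adj B) *\<^sub>v v) ` carrier_vec n"
      by (auto intro!: image_eqI[of _ _ "B *\<^sub>v c"] mult_mat_vec_carrier)
  qed
  then show ?thesis
    by (simp add: card_image[OF frame_inj_on[OF assms]] card_carrier_vec)
qed

text \<open>The projections of rank \<open>m\<close>, with the rank expressed as the number of
  columns of a frame.\<close>

definition frame_projections :: "nat \<Rightarrow> nat \<Rightarrow> 'a mat set" where
  "frame_projections n m = (\<lambda>B. B * adj B) ` frames n m"

lemma frame_projections_disjoint:
  assumes "m \<noteq> m'"
  shows "frame_projections n m \<inter> frame_projections n m' = {}"
proof (rule ccontr)
  assume "frame_projections n m \<inter> frame_projections n m' \<noteq> {}"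
  then obtain B B' where "B \<in> frames n m" "B' \<in> frames n m'" "B * adj B = B' * adj B'"
    by (auto simp: frame_projections_def)
  then have "q ^ (2 * m) = q ^ (2 * m')"
    by (metis card_range_frame_projection)
  with assms q_gt_2 show False by simp
qed

text \<open>Frames with the same projection differ by a unique unitary matrix:
  \<open>B = B0 * U\<close> with \<open>U = adj B0 * B\<close>.\<close>

lemma card_frames_fibre:
  assumes "B0 \<in> frames n m"
  shows "card {B \<in> frames n m. B * adj B = B0 * adj B0} = card (frames m m)"
proof (rule bij_betw_same_card[of "\<lambda>B. adj B0 * B"],
    rule bij_betw_byWitness[where f' = "\<lambda>U. B0 * U"])
  have B0: "B0 \<in> carrier_mat n m" "adj B0 \<in> carrier_mat m n" "adj B0 * B0 = 1\<^sub>m m"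
    using assms by (auto simp: frames_def)
  show "\<forall>B \<in> {B \<in> frames n m. B * adj B = B0 * adj B0}. B0 * (adj B0 * B) = B"
  proof clarify
    fix B assume B': "B \<in> frames n m" "B * adj B = B0 * adj B0"
    then have B: "B \<in> carrier_mat n m" "adj B \<in> carrier_mat m n" "adj B * B = 1\<^sub>m m"
      by (auto simp: frames_def)
    have "B0 * (adj B0 * B) = B * adj B * B"
      using B B0 by (simp add: B'(2) assoc_mult_mat[of _ n m _ n _ m])
    also have "\<dots> = B * (adj B * B)"
      using B by (intro assoc_mult_mat) auto
    finally show "B0 * (adj B0 * B) = B" using B by simp
  qed
  show "\<forall>U \<in> frames m m. adj B0 * (B0 * U) = U"
  proof
    fix U assume "U \<in> frames m m"
    then have "U \<in> carrier_mat m m" by (simp add: frames_def)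
    then show "adj B0 * (B0 * U) = U"
      using B0 by (simp add: assoc_mult_mat[of _ m n _ m _ m, symmetric])
  qed
  show "(\<lambda>B. adj B0 * B) ` {B \<in> frames n m. B * adj B = B0 * adj B0} \<subseteq> frames m m"
  proof clarify
    fix B assume B': "B \<in> frames n m" "B * adj B = B0 * adj B0"
    then have B: "B \<in> carrier_mat n m" "adj B \<in> carrier_mat m n" "adj B * B = 1\<^sub>m m"
      by (auto simp: frames_def)
    have "adj (adj B0 * B) * (adj B0 * B) = adj B * (B0 * (adj B0 * B))"
      using B B0 by (simp add: adj_mult[of _ m n _ m] assoc_mult_mat[of _ m n _ m _ m])
    also have "B0 * (adj B0 * B) = B * adj B * B"
      using B B0 by (simp add: B'(2) assoc_mult_mat[of _ n m _ n _ m])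
    also have "\<dots> = B * (adj B * B)"
      using B by (intro assoc_mult_mat) auto
    finally show "adj B0 * B \<in> frames m m"
      using B B0 by (simp add: frames_def)
  qed
  show "(\<lambda>U. B0 * U) ` frames m m \<subseteq> {B \<in> frames n m. B * adj B = B0 * adj B0}"
  proof (rule image_subsetI, rule CollectI, rule conjI)
    fix U assume "U \<in> frames m m"
    then have U: "U \<in> carrier_mat m m" "adj U \<in> carrier_mat m m" "adj U * U = 1\<^sub>m m"
      by (auto simp: frames_def)
    have UU: "U * adj U = 1\<^sub>m m"
      using U mat_mult_left_right_inverse[of "adj U" m U] by simp
    have adj: "adj (B0 * U) = adj U * adj B0"
      using B0 U by (simp add: adj_mult[of _ n m _ m])
    have "adj (B0 * U) * (B0 * U) = adj U * (adj B0 * (B0 * U))"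
      unfolding adj using B0 U by (intro assoc_mult_mat) auto
    also have "adj B0 * (B0 * U) = U"
      using B0 U by (simp add: assoc_mult_mat[of _ m n _ m _ m, symmetric])
    finally show "B0 * U \<in> frames n m" using B0 U by (simp add: frames_def)
    have "(B0 * U) * adj (B0 * U) = B0 * (U * (adj U * adj B0))"
      unfolding adj using B0 U by (intro assoc_mult_mat) auto
    also have "U * (adj U * adj B0) = adj B0"
      using B0 U UU assoc_mult_mat[of U m m "adj U" m "adj B0" n] by simp
    finally show "(B0 * U) * adj (B0 * U) = B0 * adj B0" .
  qed
qed

lemma card_frames_eq: "card (frames n m) = card (frame_projections n m) * card (frames m m)"
proof -
  have "frames n m = (\<Union>P\<in>frame_projections n m. {B \<in> frames n m. B * adj B = P})"
    by (auto simp: frame_projections_def)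
  also have "card \<dots> = (\<Sum>P\<in>frame_projections n m. card {B \<in> frames n m. B * adj B = P})"
    using finite_frames[of n m] by (intro card_UN_disjoint) (auto simp: frame_projections_def)
  also have "\<dots> = (\<Sum>P\<in>frame_projections n m. card (frames m m))"
    by (intro sum.cong refl) (auto simp: frame_projections_def card_frames_fibre)
  finally show ?thesis by simp
qed

section \<open>Counting frames column by column\<close>

lemma frame_Cons:
  assumes "B \<in> carrier_mat n m" "v \<in> carrier_vec n"
  shows "mat_of_cols n (v # cols B) \<in> frames n (Suc m) \<longleftrightarrow>
    B \<in> frames n m \<and> v \<in> unit_vectors n \<and> adj B *\<^sub>v v = 0\<^sub>v m"
proof -
  let ?C = "mat_of_cols n (v # cols B)"
  have C: "?C \<in> carrier_mat n (Suc m)" using assms by (auto simp: mat_of_cols_def)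
  have col0: "col ?C 0 = v" using assms by simp
  have colS: "col ?C (Suc i) = col B i" if "i < m" for i
    using assms that by simp
  have "adj B *\<^sub>v v = 0\<^sub>v m \<longleftrightarrow> (\<forall>i<m. (adj B *\<^sub>v v) $ i = 0)"
    using assms by (auto simp: adj_def vec_eq_iff)
  then have *: "adj B *\<^sub>v v = 0\<^sub>v m \<longleftrightarrow> (\<forall>i<m. form v (col B i) = 0)"
    using assms by (simp add: adj_mult_vec_index del: index_mult_mat_vec)
  have **: "form (col B i) v = 0 \<longleftrightarrow> form v (col B i) = 0" if "i < m" for i
  proof -
    have "form v (col B i) ^ q = form (col B i) v"
      using assms that by (intro form_conj[of _ n]) auto
    then show ?thesis using q_gt_2 by (metis power_eq_0_iff form_conj assms(2) col_carrier_vec[OF that assms(1)] not_gr_zero gr_implies_not0)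
  qed
  show ?thesis
    unfolding frames_iff[of ?C] frames_iff[of B] *
    using C assms
    by (auto simp: All_less_Suc2 col0 colS unit_vectors_def ** simp del: col_mat_of_cols)
qed

text \<open>Splitting off the first column leaves a smaller frame and a unit vector orthogonal to
  it.\<close>

lemma card_frames_Suc_eq:
  "card (frames n (Suc m)) = (\<Sum>B\<in>frames n m. card {v \<in> unit_vectors n. adj B *\<^sub>v v = 0\<^sub>v m})"
proof -
  let ?S = "SIGMA B:frames n m. {v \<in> unit_vectors n. adj B *\<^sub>v v = 0\<^sub>v m}"
  let ?f = "\<lambda>(B, v). mat_of_cols n (v # cols B)" and ?g = "\<lambda>C. (mat_of_cols n (tl (cols C)), col C 0)"
  have fin: "finite {v \<in> unit_vectors n. adj B *\<^sub>v v = 0\<^sub>v m}" for B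
    using card_carrier_vec(1)[of n] by (simp add: unit_vectors_def)
  have fg: "?f (?g C) = C" and g: "mat_of_cols n (tl (cols C)) \<in> carrier_mat n m" "col C 0 \<in> carrier_vec n"
    if "C \<in> frames n (Suc m)" for C
  proof -
    from that have C: "C \<in> carrier_mat n (Suc m)" by (simp add: frames_def)
    then have cols: "cols C = col C 0 # tl (cols C)" "length (tl (cols C)) = m"
      by (auto simp: cols_def upt_conv_Cons simp del: upt_Suc)
    have "set (cols C) \<subseteq> carrier_vec n" using C cols_dim[of C] by simp
    then have sub: "set (tl (cols C)) \<subseteq> carrier_vec n"
      using cols(1) by (metis set_subset_Cons subset_trans)
    show "mat_of_cols n (tl (cols C)) \<in> carrier_mat n m" using cols by auto
    show "col C 0 \<in> carrier_vec n" by (rule col_carrier_vec[OF _ C]) simp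
    show "?f (?g C) = C"
      using sub C cols by (simp add: cols_mat_of_cols) (metis carrier_matD(1) mat_of_cols_cols)
  qed
  have "bij_betw ?f ?S (frames n (Suc m))"
  proof (rule bij_betw_byWitness[where f' = ?g])
    show "\<forall>x\<in>?S. ?g (?f x) = x"
    proof
      fix x assume "x \<in> ?S"
      then obtain B v where x: "x = (B, v)" and "B \<in> frames n m" "v \<in> unit_vectors n"
        by auto
      then have B: "B \<in> carrier_mat n m" and v: "v \<in> carrier_vec n"
        by (auto simp: frames_def unit_vectors_def)
      then have "cols (mat_of_cols n (v # cols B)) = v # cols B"
        using cols_dim[of B] by (intro cols_mat_of_cols) auto
      moreover have "col (mat_of_cols n (v # cols B)) 0 = v" using v by simp
      moreover have "mat_of_cols n (cols B) = B" using B mat_of_cols_cols[of B] by simp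
      ultimately show "?g (?f x) = x" by (simp add: x del: col_mat_of_cols)
    qed
    show "\<forall>C\<in>frames n (Suc m). ?f (?g C) = C" using fg by blast
    show "?f ` ?S \<subseteq> frames n (Suc m)"
    proof clarify
      fix B v assume *: "B \<in> frames n m" "v \<in> unit_vectors n" "adj B *\<^sub>v v = 0\<^sub>v m"
      then have "B \<in> carrier_mat n m" "v \<in> carrier_vec n"
        by (auto simp: frames_def unit_vectors_def)
      with * show "mat_of_cols n (v # cols B) \<in> frames n (Suc m)"
        by (simp add: frame_Cons)
    qed
    show "?g ` frames n (Suc m) \<subseteq> ?S"
    proof (rule image_subsetI)
      fix C assume C: "C \<in> frames n (Suc m)"
      show "?g C \<in> ?S"
        using frame_Cons[OF g[OF C]] fg[OF C] C by auto
    qed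
  qed
  then have "card (frames n (Suc m)) = card ?S"
    by (rule bij_betw_same_card[symmetric])
  also have "\<dots> = (\<Sum>B\<in>frames n m. card {v \<in> unit_vectors n. adj B *\<^sub>v v = 0\<^sub>v m})"
    using fin finite_frames by (intro card_SigmaI) auto
  finally show ?thesis .
qed

text \<open>Polarization: if all vectors in the range of \<open>Q\<close> are isotropic, then replacing \<open>w\<close> by a multiple
  \<open>\<lambda> w\<close> with \<open>\<lambda>\<close> not fixed by conjugation shows that the form vanishes on the range.\<close>
lemma ex_unit_vector_in_range:
  assumes Q: "Q \<in> projections n" and "Q \<noteq> 0\<^sub>m n n"
  shows "\<exists>v \<in> unit_vectors n. Q *\<^sub>v v = v"
proof -
  have Q': "Q \<in> carrier_mat n n" "adj Q = Q" "Q * Q = Q"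
    using Q by (auto simp: projections_def)
  have QQ: "Q *\<^sub>v (Q *\<^sub>v v) = Q *\<^sub>v v" if "v \<in> carrier_vec n" for v
    using that Q' assoc_mult_mat_vec[of Q n n Q n v] by simp
  have cl: "Q *\<^sub>v v \<in> carrier_vec n" if "v \<in> carrier_vec n" for v
    using that Q' by (intro mult_mat_vec_carrier)
  have "\<exists>v \<in> carrier_vec n. form (Q *\<^sub>v v) (Q *\<^sub>v v) \<noteq> 0"
  proof (rule ccontr)
    assume "\<not> ?thesis"
    then have iso: "form (Q *\<^sub>v v) (Q *\<^sub>v v) = 0" if "v \<in> carrier_vec n" for v
      using that by blast
    obtain l :: 'a where l: "l ^ q \<noteq> l" using ex_not_fixed by blast
    have zero: "form (Q *\<^sub>v v) (Q *\<^sub>v w) = 0" if vw: "v \<in> carrier_vec n" "w \<in> carrier_vec n" for v w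
    proof -
      let ?v = "Q *\<^sub>v v" and ?w = "Q *\<^sub>v w"
      have 1: "c ^ q * form ?v ?w + c * form ?w ?v = 0" for c
      proof -
        have "Q *\<^sub>v (v + c \<cdot>\<^sub>v w) = ?v + c \<cdot>\<^sub>v ?w"
          using vw Q' by (simp add: mult_add_distrib_mat_vec[of _ n n] mult_mat_vec[of _ n n])
        then have "form (?v + c \<cdot>\<^sub>v ?w) (?v + c \<cdot>\<^sub>v ?w) = 0"
          using iso[of "v + c \<cdot>\<^sub>v w"] vw by simp
        then show ?thesis
          using vw cl iso[OF vw(1)] iso[OF vw(2)]
          by (simp add: form_add_left[of _ n] form_add_right[of _ n] form_smult_left
              form_smult_right[of _ n] add.commute)
      qed
      \<comment> \<open>The case \<open>c = 1\<close> gives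
        \<open>form ?w ?v = - form ?v ?w\<close>, which is substituted into the case
        \<open>c = l\<close>.\<close>
      have "(l ^ q - l) * form ?v ?w = 0"
        using 1[of l] 1[of 1] by (simp add: algebra_simps add_eq_0_iff)
      with l show ?thesis by simp
    qed
    \<comment> \<open>Since \<open>Q = adj Q * Q\<close>, its entries are values of the form on its
      columns, which lie in its range.\<close>
    have "Q $$ (i, j) = 0" if "i < n" "j < n" for i j
      using adj_mult_index[OF Q'(1) Q'(1) that] zero[of "unit_vec n j" "unit_vec n i"] that Q'
      by (simp add: mult_unit_vec[of Q n n] del: index_mult_mat)
    then have "Q = 0\<^sub>m n n" using Q' by (intro eq_matI) auto
    with assms show False by simp
  qed
  then obtain v where v: "v \<in> carrier_vec n" "form (Q *\<^sub>v v) (Q *\<^sub>v v) \<noteq> 0" by blast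
  let ?a = "form (Q *\<^sub>v v) (Q *\<^sub>v v)"
  \<comment> \<open>Being fixed by conjugation, the inverse of \<open>?a\<close> is a norm, and
    scaling by an element \<open>c\<close> of that norm produces a unit vector.\<close>
  have "inverse ?a ^ q = inverse ?a" by (simp add: power_inverse form_self_conj)
  then obtain c where c: "c ^ (q + 1) = inverse ?a"
    using ex_norm_eq[of "inverse ?a"] v by auto
  have "form (c \<cdot>\<^sub>v (Q *\<^sub>v v)) (c \<cdot>\<^sub>v (Q *\<^sub>v v)) = c ^ (q + 1) * ?a"
    using cl[OF v(1)] by (simp add: form_smult_left form_smult_right[of _ n])
  then have "form (c \<cdot>\<^sub>v (Q *\<^sub>v v)) (c \<cdot>\<^sub>v (Q *\<^sub>v v)) = 1"
    using c v by simp
  moreover have "Q *\<^sub>v (c \<cdot>\<^sub>v (Q *\<^sub>v v)) = c \<cdot>\<^sub>v (Q *\<^sub>v v)"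
    using cl[OF v(1)] Q' QQ[OF v(1)] by (simp add: mult_mat_vec[of _ n n])
  ultimately show ?thesis
    using cl[OF v(1)] by (intro bexI[of _ "c \<cdot>\<^sub>v (Q *\<^sub>v v)"]) (auto simp: unit_vectors_def)
qed

lemma zero_mult_mat_vec:
  fixes v :: "'a vec"
  assumes "v \<in> carrier_vec n"
  shows "0\<^sub>m m n *\<^sub>v v = 0\<^sub>v m"
  using assms by (intro eq_vecI) auto

text \<open>Writing \<open>R\<close> for \<open>B * adj B\<close>, the hypothesis gives
  \<open>P * R = R\<close>, and taking adjoints \<open>R * P = R\<close>. Hence subtracting
  \<open>R\<close> leaves a projection orthogonal to the columns of \<open>B\<close>.\<close>

lemma projection_diff_frame:
  assumes P: "P \<in> projections n" and B: "B \<in> frames n m" and PB: "P * B = B"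
  shows "P - B * adj B \<in> projections n" "(P - B * adj B) * B = 0\<^sub>m n m"
    "P * (P - B * adj B) = P - B * adj B"
proof -
  have P': "P \<in> carrier_mat n n" "adj P = P" "P * P = P"
    using P by (auto simp: projections_def)
  have B': "B \<in> carrier_mat n m" "adj B \<in> carrier_mat m n" "adj B * B = 1\<^sub>m m"
    using B by (auto simp: frames_def)
  let ?R = "B * adj B"
  have R: "?R \<in> carrier_mat n n" "adj ?R = ?R" "?R * ?R = ?R"
    using frame_mult_adj_projection[OF B] by (auto simp: projections_def)
  have PR: "P * ?R = ?R"
    using P' B' PB assoc_mult_mat[of P n n B m "adj B" n] by simp
  have "adj (P * ?R) = ?R * P"
    using adj_mult[OF P'(1) R(1)] P' R by simp
  with PR R have RP: "?R * P = ?R" by simp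
  have D: "P - ?R \<in> carrier_mat n n" using R by (simp add: minus_carrier_mat)
  have adjD: "adj (P - ?R) = P - ?R"
    using adj_minus[OF P'(1) R(1)] P' R by simp
  show "P * (P - ?R) = P - ?R"
    using mult_minus_distrib_mat[OF P'(1) P'(1) R(1)] P' PR by simp
  have "?R * (P - ?R) = 0\<^sub>m n n"
    using mult_minus_distrib_mat[OF R(1) P'(1) R(1)] R RP by simp
  moreover have "X - 0\<^sub>m n n = X" if "X \<in> carrier_mat n n" for X :: "'a mat"
    using that by (intro eq_matI) auto
  ultimately have "(P - ?R) * (P - ?R) = P - ?R"
    using minus_mult_distrib_mat[OF P'(1) R(1) D] \<open>P * (P - ?R) = P - ?R\<close> D by simp
  with D adjD show "P - ?R \<in> projections n" by (simp add: projections_def)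
  have "?R * B = B" using assoc_mult_mat[of B n m "adj B" n B m] B' by simp
  then show "(P - ?R) * B = 0\<^sub>m n m"
    using minus_mult_distrib_mat[OF P'(1) R(1) B'(1)] PB B' by simp
qed

text \<open>A frame of maximal size within the range of \<open>P\<close> is taken. If
  \<open>P - B * adj B\<close> were nonzero, a unit vector in its range would extend the
  frame.\<close>

lemma projection_eq_frame_mult_adj:
  assumes P: "P \<in> projections n"
  shows "\<exists>m. \<exists>B \<in> frames n m. P = B * adj B"
proof -
  have P': "P \<in> carrier_mat n n" "adj P = P" "P * P = P"
    using P by (auto simp: projections_def)
  define ok where "ok m \<longleftrightarrow> (\<exists>B \<in> frames n m. P * B = B)" for m
  have "mat_of_cols n [] \<in> frames n 0"
    by (auto simp: frames_iff mat_of_cols_def)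
  moreover have "P * mat_of_cols n [] = mat_of_cols n []"
    using P' by (intro eq_matI) auto
  ultimately have "ok 0" by (auto simp: ok_def)
  moreover have "m < Suc n" if "ok m" for m
    using that frames_le by (auto simp: ok_def less_Suc_eq_le)
  ultimately obtain m where m: "ok m" "\<And>k. ok k \<Longrightarrow> k \<le> m"
    using ex_has_greatest_nat[of ok 0 "\<lambda>x. x" "Suc n"] by auto
  then obtain B where B: "B \<in> frames n m" "P * B = B" by (auto simp: ok_def)
  have Bc: "B \<in> carrier_mat n m" "adj B \<in> carrier_mat m n" using B by (auto simp: frames_def)
  note D = projection_diff_frame[OF P B]
  let ?D = "P - B * adj B"
  have Dc: "?D \<in> carrier_mat n n" "adj ?D = ?D" using D(1) by (auto simp: projections_def)
  have "?D = 0\<^sub>m n n"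
  proof (rule ccontr)
    assume "?D \<noteq> 0\<^sub>m n n"
    then obtain v where v: "v \<in> unit_vectors n" "?D *\<^sub>v v = v"
      using ex_unit_vector_in_range[OF D(1)] by blast
    then have vc: "v \<in> carrier_vec n" by (simp add: unit_vectors_def)
    have Pv: "P *\<^sub>v v = v"
      using assoc_mult_mat_vec[OF P'(1) Dc(1) vc] D(3) v by simp
    \<comment> \<open>Since \<open>v = ?D *\<^sub>v v\<close> and \<open>adj B * ?D\<close>
      vanishes, \<open>v\<close> is orthogonal to the columns of \<open>B\<close>.\<close>
    have "adj B * ?D = adj (?D * B)"
      using adj_mult[OF Dc(1) Bc(1)] Dc by simp
    also have "\<dots> = 0\<^sub>m m n" 
      unfolding D(2) using q_gt_2 by (auto simp: adj_def)
    finally have "adj B *\<^sub>v v = 0\<^sub>v m"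
      using assoc_mult_mat_vec[OF Bc(2) Dc(1) vc] v zero_mult_mat_vec[OF vc, of m] by simp
    then have C: "mat_of_cols n (v # cols B) \<in> frames n (Suc m)" (is "?C \<in> _")
      using frame_Cons[OF Bc(1) vc] B v by simp
    have "P * ?C = ?C"
    proof (rule mat_col_eqI)
      fix i assume "i < dim_col ?C"
      then have i: "i < Suc m" using Bc by simp
      have col: "col ?C i = (v # cols B) ! i"
        using i Bc vc by (cases i) auto
      have "P *\<^sub>v col ?C i = col ?C i"
      proof (cases i)
        case 0
        with Pv vc show ?thesis unfolding col by simp
      next
        case (Suc j)
        then have "col ?C i = col B j" using i Bc unfolding col by simp
        moreover have "P *\<^sub>v col B j = col B j"
          using col_mult2[OF P'(1) Bc(1), of j] B(2) Suc i by simp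
        ultimately show ?thesis by simp
      qed
      then show "col (P * ?C) i = col ?C i"
        using col_mult2[OF P'(1), of ?C "Suc m" i] C i by (simp add: frames_def)
    qed (use P' in auto)
    with C have "ok (Suc m)" by (auto simp: ok_def)
    with m(2) show False by force
  qed
  moreover have "P = ?D + B * adj B"
    using P' Bc by (auto intro!: eq_matI)
  ultimately have "P = B * adj B"
    using Bc by simp
  with B show ?thesis by blast
qed

lemma one_projection: "1\<^sub>m n \<in> projections n"
  by (simp add: projections_def)

text \<open>The complementary projection is \<open>C * adj C\<close> for a frame \<open>C\<close>,
  which maps \<open>carrier_vec k\<close> isometrically onto the orthogonal complement of the
  columns of \<open>B\<close>. It remains to see that \<open>k = n - m\<close>.\<close>

lemma card_unit_vectors_orthogonal:
  assumes B: "B \<in> frames n m"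
  shows "card {v \<in> unit_vectors n. adj B *\<^sub>v v = 0\<^sub>v m} = card (unit_vectors (n - m))"
proof -
  have Bc: "B \<in> carrier_mat n m" "adj B \<in> carrier_mat m n" using B by (auto simp: frames_def)
  have "1\<^sub>m n - B * adj B \<in> projections n"
    using projection_diff_frame(1)[OF one_projection B] Bc by simp
  then obtain k C where C: "C \<in> frames n k" and eq: "1\<^sub>m n - B * adj B = C * adj C"
    using projection_eq_frame_mult_adj by blast
  have Cc: "C \<in> carrier_mat n k" "adj C \<in> carrier_mat k n" using C by (auto simp: frames_def)
  have CCB: "C * adj C * B = 0\<^sub>m n m"
    using projection_diff_frame(2)[OF one_projection B] Bc eq by simp
  have split: "B *\<^sub>v (adj B *\<^sub>v v) + C *\<^sub>v (adj C *\<^sub>v v) = v" if v: "v \<in> carrier_vec n" for v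
  proof -
    have "B * adj B + C * adj C = 1\<^sub>m n"
      unfolding eq[symmetric] using Bc by (auto intro!: eq_matI)
    then have "(B * adj B + C * adj C) *\<^sub>v v = v" using v by simp
    then show ?thesis
      using v Bc Cc by (simp add: add_mult_distrib_mat_vec[of _ n n] assoc_mult_mat_vec[of _ n _ _ n])
  qed
  have adjCB: "adj C * B = 0\<^sub>m k m"
  proof -
    have "adj C * B = (adj C * C) * (adj C * B)"
      using C Cc Bc by (simp add: frames_def)
    also have "\<dots> = adj C * (C * (adj C * B))"
      using Cc Bc by (intro assoc_mult_mat) auto
    also have "C * (adj C * B) = 0\<^sub>m n m"
      using assoc_mult_mat[OF Cc Bc(1)] CCB by simp
    finally show ?thesis using Cc by simp
  qed
  have "adj B * C = adj (adj C * B)"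
    using adj_mult[OF Cc(2) Bc(1)] by simp
  also have "\<dots> = 0\<^sub>m m k"
    unfolding adjCB using q_gt_2 by (auto simp: adj_def)
  finally have adjBC: "adj B * C = 0\<^sub>m m k" .
  have CB0: "adj C *\<^sub>v (B *\<^sub>v a) = 0\<^sub>v k" if "a \<in> carrier_vec m" for a
    using assoc_mult_mat_vec[OF Cc(2) Bc(1) that] adjCB that zero_mult_mat_vec[OF that, of k] by simp
  have BC0: "adj B *\<^sub>v (C *\<^sub>v c) = 0\<^sub>v m" if "c \<in> carrier_vec k" for c
    using assoc_mult_mat_vec[OF Bc(2) Cc(1) that] adjBC that zero_mult_mat_vec[OF that, of m] by simp
  \<comment> \<open>The orthogonal decomposition of the space determines \<open>k\<close> by
    counting vectors.\<close>
  have "bij_betw (\<lambda>v. (adj B *\<^sub>v v, adj C *\<^sub>v v)) (carrier_vec n) (carrier_vec m \<times> carrier_vec k)"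
  proof (rule bij_betw_byWitness[where f' = "\<lambda>(a, c). B *\<^sub>v a + C *\<^sub>v c"])
    show "\<forall>x\<in>carrier_vec m \<times> carrier_vec k.
      (\<lambda>v. (adj B *\<^sub>v v, adj C *\<^sub>v v)) ((\<lambda>(a, c). B *\<^sub>v a + C *\<^sub>v c) x) = x"
    proof clarify
      fix a c :: "'a vec" assume ac: "a \<in> carrier_vec m" "c \<in> carrier_vec k"
      then have "B *\<^sub>v a \<in> carrier_vec n" "C *\<^sub>v c \<in> carrier_vec n"
        using Bc Cc by (auto intro: mult_mat_vec_carrier)
      then show "adj B *\<^sub>v (B *\<^sub>v a + C *\<^sub>v c) = a \<and> adj C *\<^sub>v (B *\<^sub>v a + C *\<^sub>v c) = c"
        using ac by (simp add: mult_add_distrib_mat_vec[OF Bc(2)] mult_add_distrib_mat_vec[OF Cc(2)]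
            frame_mult_vec_inverse[OF B] frame_mult_vec_inverse[OF C] CB0 BC0)
    qed
    show "\<forall>v\<in>carrier_vec n. (\<lambda>(a, c). B *\<^sub>v a + C *\<^sub>v c) (adj B *\<^sub>v v, adj C *\<^sub>v v) = v"
      using split by simp
    show "(\<lambda>v. (adj B *\<^sub>v v, adj C *\<^sub>v v)) ` carrier_vec n \<subseteq> carrier_vec m \<times> carrier_vec k"
      using mult_mat_vec_carrier[OF Bc(2)] mult_mat_vec_carrier[OF Cc(2)] by blast
    show "(\<lambda>(a, c). B *\<^sub>v a + C *\<^sub>v c) ` (carrier_vec m \<times> carrier_vec k) \<subseteq> carrier_vec n"
      using mult_mat_vec_carrier[OF Bc(1)] mult_mat_vec_carrier[OF Cc(1)] by fastforce
  qed
  then have "card (carrier_vec n :: 'a vec set) = card (carrier_vec m \<times> carrier_vec k :: ('a vec \<times> 'a vec) set)"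
    by (rule bij_betw_same_card)
  then have "q ^ (2 * n) = q ^ (2 * (m + k))"
    by (simp add: card_carrier_vec card_cartesian_product power_add)
  then have k: "k = n - m"
    using q_gt_2 by simp
  have "bij_betw (\<lambda>v. adj C *\<^sub>v v) {v \<in> unit_vectors n. adj B *\<^sub>v v = 0\<^sub>v m} (unit_vectors k)"
  proof (rule bij_betw_byWitness[where f' = "\<lambda>c. C *\<^sub>v c"])
    have *: "C *\<^sub>v (adj C *\<^sub>v v) = v" if "v \<in> carrier_vec n" "adj B *\<^sub>v v = 0\<^sub>v m" for v
    proof -
      have "B *\<^sub>v 0\<^sub>v m = 0\<^sub>v n" using Bc by (intro eq_vecI) auto
      moreover have "C *\<^sub>v (adj C *\<^sub>v v) \<in> carrier_vec n"
        using Cc that by (intro mult_mat_vec_carrier) auto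
      ultimately show ?thesis using split[OF that(1)] that(2) by simp
    qed
    then show "\<forall>v\<in>{v \<in> unit_vectors n. adj B *\<^sub>v v = 0\<^sub>v m}. C *\<^sub>v (adj C *\<^sub>v v) = v"
      by (simp add: unit_vectors_def)
    show "\<forall>c\<in>unit_vectors k. adj C *\<^sub>v (C *\<^sub>v c) = c"
      by (simp add: unit_vectors_def frame_mult_vec_inverse[OF C])
    show "(\<lambda>v. adj C *\<^sub>v v) ` {v \<in> unit_vectors n. adj B *\<^sub>v v = 0\<^sub>v m} \<subseteq> unit_vectors k"
    proof (rule image_subsetI)
      fix v assume "v \<in> {v \<in> unit_vectors n. adj B *\<^sub>v v = 0\<^sub>v m}"
      then have v: "v \<in> carrier_vec n" "form v v = 1" "adj B *\<^sub>v v = 0\<^sub>v m"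
        by (auto simp: unit_vectors_def)
      have "adj C *\<^sub>v v \<in> carrier_vec k" using Cc v by (intro mult_mat_vec_carrier)
      moreover from frame_form[OF C this this] have "form (adj C *\<^sub>v v) (adj C *\<^sub>v v) = 1"
        using *[of v] v by simp
      ultimately show "adj C *\<^sub>v v \<in> unit_vectors k" by (simp add: unit_vectors_def)
    qed
    show "(\<lambda>c. C *\<^sub>v c) ` unit_vectors k \<subseteq> {v \<in> unit_vectors n. adj B *\<^sub>v v = 0\<^sub>v m}"
      using Cc by (auto simp: unit_vectors_def BC0 frame_form[OF C] intro: mult_mat_vec_carrier)
  qed
  then show ?thesis unfolding k by (rule bij_betw_same_card)
qed

lemma card_frames: "card (frames n m) = (\<Prod>i<m. card (unit_vectors (n - i)))"
proof (induction m)
  case 0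
  have "frames n 0 = {mat_of_cols n []}"
    by (auto simp: frames_iff mat_of_cols_def intro!: eq_matI)
  then show ?case by simp
next
  case (Suc m)
  then show ?case
    by (simp add: card_frames_Suc_eq card_unit_vectors_orthogonal)
qed

section \<open>The number of involutions and its limits\<close>

text \<open>Projections are sorted by rank \<open>m\<close>; those of rank \<open>m\<close> number
  \<open>card (frames n m)\<close> divided by \<open>card (frames m m)\<close>, which is positive
  because of the identity.\<close>

lemma num_involutions_eq:
  "num_involutions_U TYPE('a) n q
    = (\<Sum>m\<le>n. (\<Prod>i<m. real (card (unit_vectors (n - i))) / real (card (unit_vectors (m - i)))))"
proof -
  have fin: "finite (frame_projections n m)" for m
    by (simp add: frame_projections_def finite_frames)
  have "projections n = (\<Union>m\<le>n. frame_projections n m)"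
  proof (intro equalityI subsetI)
    fix P assume "P \<in> projections n"
    then obtain m B where "B \<in> frames n m" "P = B * adj B"
      using projection_eq_frame_mult_adj by blast
    then have "m \<le> n" "P \<in> frame_projections n m"
      using frames_le by (auto simp: frame_projections_def)
    then show "P \<in> (\<Union>m\<le>n. frame_projections n m)" by blast
  qed (auto simp: frame_projections_def frame_mult_adj_projection)
  then have "card (projections n) = (\<Sum>m\<le>n. card (frame_projections n m))"
    using fin frame_projections_disjoint by (simp add: card_UN_disjoint)
  also have "real \<dots> = (\<Sum>m\<le>n. (\<Prod>i<m. real (card (unit_vectors (n - i))) / real (card (unit_vectors (m - i)))))"
    unfolding of_nat_sum
  proof (intro sum.cong refl)
    fix m
    have "1\<^sub>m m \<in> frames m m" by (simp add: frames_def)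
    then have "card (frames m m) > 0" using finite_frames card_gt_0_iff by blast
    then have "real (card (frame_projections n m)) = card (frames n m) / card (frames m m)"
      by (simp add: card_frames_eq[of n m])
    then show "real (card (frame_projections n m)) =
      (\<Prod>i<m. real (card (unit_vectors (n - i))) / real (card (unit_vectors (m - i))))"
      by (simp add: card_frames prod_dividef)
  qed
  finally show ?thesis by (simp add: num_involutions_eq_card_projections)
qed

lemma prod_card_unit_vectors_ratio:
  assumes k: "k \<le> n"
  shows "(\<Prod>i<k. real (card (unit_vectors (n - i))) / real (card (unit_vectors (k - i))))
    = real q ^ (2 * k * (n - k)) * qbinom (- 1 / real q) n k"
proof -
  let ?r = "- 1 / real q" and ?s = "\<lambda>n. real (card (unit_vectors n))"
  have q: "real q > 0" and r: "\<bar>?r\<bar> < 1" using q_gt_2 by auto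
  have "?s (n - i) / ?s (k - i) = real q ^ (2 * (n - k)) * ((1 - ?r ^ (n - i)) / (1 - ?r ^ (k - i)))"
    if i: "i < k" for i
  proof -
    \<comment> \<open>Expanding by \<open>q\<close> brings both counts into the form of
      \<open>card_unit_vectors\<close>.\<close>
    have "?s (n - i) / ?s (k - i) = (real q * ?s (n - i)) / (real q * ?s (k - i))"
      using q by simp
    also have "\<dots> = real q ^ (2 * (n - i)) / real q ^ (2 * (k - i)) * ((1 - ?r ^ (n - i)) / (1 - ?r ^ (k - i)))"
      unfolding card_unit_vectors by simp
    also have "2 * (n - i) = 2 * (n - k) + 2 * (k - i)" using i k by auto
    also have "real q ^ (2 * (n - k) + 2 * (k - i)) / real q ^ (2 * (k - i)) = real q ^ (2 * (n - k))"
      using q by (simp add: power_add)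
    finally show ?thesis .
  qed
  then have "(\<Prod>i<k. ?s (n - i) / ?s (k - i))
      = (\<Prod>i<k. real q ^ (2 * (n - k)) * ((1 - ?r ^ (n - i)) / (1 - ?r ^ (k - i))))"
    by (intro prod.cong) auto
  also have "\<dots> = (real q ^ (2 * (n - k))) ^ k * ((\<Prod>i<k. 1 - ?r ^ (n - i)) / (\<Prod>i<k. 1 - ?r ^ (k - i)))"
    by (simp only: prod.distrib prod_dividef prod_constant card_lessThan)
  also have "(real q ^ (2 * (n - k))) ^ k = real q ^ (2 * k * (n - k))"
    by (simp only: power_mult[symmetric] mult_ac)
  also have "(\<Prod>i<k. 1 - ?r ^ (n - i)) = qpoch ?r n / qpoch ?r (n - k)"
    by (rule prod_qpoch[OF r k])
  also have "(\<Prod>i<k. 1 - ?r ^ (k - i)) = qpoch ?r k"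
    using prod_qpoch[OF r order_refl, of k] by (simp add: qpoch_def[of _ 0])
  finally show ?thesis using k by (simp add: qbinom_def mult.commute)
qed

text \<open>For \<open>k = m + e + j\<close> and \<open>n = 2 * m + e\<close> one has k(n - k) = m(m
  + e) - j(j + e), so dividing by the central power of \<open>q\<close> leaves a theta exponent in
  base q^(-2).\<close>

lemma num_involutions_theta:
  assumes e: "e \<le> 1"
  shows "real (num_involutions_U TYPE('a) (2 * m + e) q) / real q ^ (2 * m * (m + e))
    = (\<Sum>j\<le>m. theta_weight e (1 / real q ^ 2) j * qbinom (- 1 / real q) (2 * m + e) (m + e + j))"
proof -
  let ?r = "- 1 / real q"
  let ?F = "\<lambda>k. real q ^ (2 * k * (2 * m + e - k)) * qbinom ?r (2 * m + e) k"
  have q: "real q > 0" using q_gt_2 by auto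
  have "real (num_involutions_U TYPE('a) (2 * m + e) q) = (\<Sum>k\<le>2 * m + e. ?F k)"
    unfolding num_involutions_eq by (intro sum.cong refl prod_card_unit_vectors_ratio) simp
  also have "\<dots> = (\<Sum>j\<le>m. (if e = 0 \<and> j = 0 then 1 else 2) * ?F (m + e + j))"
    by (rule sum_fold_symmetric[OF e]) (simp add: qbinom_sym mult_ac)
  also have "\<dots> = (\<Sum>j\<le>m. real q ^ (2 * m * (m + e)) *
      (theta_weight e (1 / real q ^ 2) j * qbinom ?r (2 * m + e) (m + e + j)))"
  proof (intro sum.cong refl)
    fix j assume "j \<in> {..m}"
    then have "j \<le> m" by simp
    from le_Suc_ex[OF this] obtain l where l: "m = j + l" by blast
    have "2 * m * (m + e) = 2 * (m + e + j) * (2 * m + e - (m + e + j)) + 2 * (j * (j + e))"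
      by (simp add: l algebra_simps)
    then have "real q ^ (2 * m * (m + e))
        = real q ^ (2 * (m + e + j) * (2 * m + e - (m + e + j))) * real q ^ (2 * (j * (j + e)))"
      by (simp only: power_add)
    moreover have "(1 / real q ^ 2) ^ (j * (j + e)) * real q ^ (2 * (j * (j + e))) = 1"
      using q by (simp add: power_mult power_one_over)
    ultimately have "real q ^ (2 * (m + e + j) * (2 * m + e - (m + e + j)))
        = real q ^ (2 * m * (m + e)) * (1 / real q ^ 2) ^ (j * (j + e))"
      by (simp add: mult_ac)
    then show "(if e = 0 \<and> j = 0 then 1 else 2) * ?F (m + e + j) = real q ^ (2 * m * (m + e)) *
      (theta_weight e (1 / real q ^ 2) j * qbinom ?r (2 * m + e) (m + e + j))"
      by (simp add: theta_weight_def)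
  qed
  finally show ?thesis
    using q by (simp add: sum_distrib_left[symmetric])
qed

lemma num_involutions_LIMSEQ:
  assumes e: "e \<le> 1"
  defines "f \<equiv> \<lambda>j. (1 + real q powi (- int (2 * (2 * j + 1 + e)))) ^ 2 *
    (1 - real q powi (- int (2 * (2 * j + 2)))) / (1 - (- 1 / real q) ^ Suc j)"
  shows "convergent_prod f"
    and "(\<lambda>m. real (num_involutions_U TYPE('a) (2 * m + e) q) / real q ^ (2 * m * (m + e)))
      \<longlonglongrightarrow> 2 ^ e * (\<Prod>j. f j)"
proof -
  let ?x = "1 / real q ^ 2" and ?r = "- 1 / real q"
  have q: "real q > 1" using q_gt_2 by simp
  have r: "\<bar>?r\<bar> < 1" and x: "0 < ?x" "?x < 1" using q by (auto simp: one_less_power)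
  have powi: "real q powi (- int (2 * k)) = ?x ^ k" for k
    by (simp only: power_int_minus power_int_of_nat power_mult power_one_over inverse_eq_divide)
  have f: "f = (\<lambda>i. (1 + ?x ^ (2 * i + 1 + e)) ^ 2 * (1 - ?x ^ (2 * i + 2)) / (1 - ?r ^ Suc i))"
    unfolding f_def powi ..
  show "convergent_prod f"
    unfolding f by (rule theta_sum_LIMSEQ_prod(1)[OF r x e])
  show "(\<lambda>m. real (num_involutions_U TYPE('a) (2 * m + e) q) / real q ^ (2 * m * (m + e)))
      \<longlonglongrightarrow> 2 ^ e * (\<Prod>j. f j)"
    unfolding f num_involutions_theta[OF e] by (rule theta_sum_LIMSEQ_prod(2)[OF r x e])
qed

end

theorem theorem3p6:
  fixes q :: nat
  assumes "primepow q" and "odd q"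
    and "CARD('a :: {field, finite}) = q ^ 2"
  shows
    "(let f = (\<lambda>k :: nat. (1 + real q powi (2 - 4 * int k)) ^ 2 * (1 - real q powi (- 4 * int k))
                / (1 - (- 1 / real q) ^ k))
      in convergent_prod (\<lambda>j. f (Suc j))
       \<and> ((\<lambda>n. real (num_involutions_U TYPE('a) n q) / real q powr ((real n) ^ 2 / 2))
            \<longlongrightarrow> (\<Prod>j. f (Suc j))) (inf at_top (principal {n. even n})))
     \<and>
     (let f = (\<lambda>k :: nat. (1 + real q powi (- 4 * int k)) ^ 2 * (1 - real q powi (- 4 * int k))
                / (1 - (- 1 / real q) ^ k))
      in convergent_prod (\<lambda>j. f (Suc j))
       \<and> ((\<lambda>n. real (num_involutions_U TYPE('a) n q) / real q powr (((real n) ^ 2 - 1) / 2))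
            \<longlongrightarrow> 2 * (\<Prod>j. f (Suc j))) (inf at_top (principal {n. odd n})))"
proof -
  interpret hermitian_field q "TYPE('a)"
    using assms by unfold_locales
  have q: "real q > 0" using q_gt_2 by simp
  \<comment> \<open>For \<open>n = 2 * m + e\<close> both normalizing exponents are
    \<open>2 * m * (m + e)\<close>.\<close>
  have even: "real q powr ((real (2 * m)) ^ 2 / 2) = real q ^ (2 * m * (m + 0))" for m
  proof -
    have "(real (2 * m)) ^ 2 / 2 = real (2 * m * (m + 0))"
      by (simp add: power2_eq_square)
    then show ?thesis using q by (simp only: powr_realpow)
  qed
  have odd: "real q powr (((real (2 * m + 1)) ^ 2 - 1) / 2) = real q ^ (2 * m * (m + 1))" for m
  proof -
    have "((real (2 * m + 1)) ^ 2 - 1) / 2 = real (2 * m * (m + 1))"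
      by (simp add: power2_eq_square algebra_simps)
    then show ?thesis using q by (simp only: powr_realpow)
  qed
  \<comment> \<open>The products of the theorem start at \<open>k = 1\<close>, hence
    \<open>k = Suc j\<close>.\<close>
  have exps: "2 - 4 * int (Suc j) = - int (2 * (2 * j + 1 + 0))"
    "- 4 * int (Suc j) = - int (2 * (2 * j + 2))"
    "int (2 * (2 * j + 1 + 1)) = int (2 * (2 * j + 2))" for j
    by simp_all
  have mod2: "{n. even n} = {n :: nat. n mod 2 = 0}" "{n. odd n} = {n :: nat. n mod 2 = 1}"
    by (simp_all add: even_iff_mod_2_eq_zero odd_iff_mod_2_eq_one)
  note even_case = num_involutions_LIMSEQ[of 0] and odd_case = num_involutions_LIMSEQ[of 1]
  show ?thesis
    unfolding Let_def exps(1,2) mod2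
    using even_case odd_case
    by (intro conjI tendsto_mod_2I) (simp_all only: even odd exps(3) zero_le_one order_refl
        add_0_right power_0 power_one_right mult_1)
qed

end
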